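(* Let $g:\{0,1\}^n\to\mathcal I$ be an efficiently computable function (computable in time polynomial in $n$) into a finite set $\mathcal I$, let $\mathcal D_g$ be the distribution of $g(X)$ for $X$ uniform on $\{0,1\}^n$, and let $\lambda\in(0,1]$, $\epsilon\in(0,1)$, $T\ge 2$. Fix a constant failure probability $\delta\in(0,1)$. Then there is an adaptive data analysis mechanism $\mathcal M$ (which knows $g,\lambda,\epsilon,\delta,T$ but not the target distribution) such that for every distribution $\mathcal D$ over $\mathcal I$ that is $\lambda$-dense with respect to $\mathcal D_g$ and every analyst adaptively choosing a sequence of $T$ queries $q_1,\dots,q_T:\mathcal I\to\{-1,1\}$, the answers $a_1,\dots,a_T$ of $\mathcal M$ satisfy, with probability at least $1-\delta$, $$\left|a_t-\mathbb E_{k\sim\mathcal D}[q_t(k)]\right|\le\epsilon\quad\text{for all }t\in\{1,\dots,T\},$$ where $\mathcal M$ uses only $M\in O(\lambda^{-2}\epsilon^{-4}\log T)$ i.i.d. samples from $\mathcal D$ and runs in time polynomial in $n,\epsilon^{-1},\lambda^{-1},T$ (with constants depending only on $\delta$).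
   Context: A distribution $\mathcal D$ over $\mathcal I$ is $\lambda$-dense with respect to $\mathcal D_g$ if $\Pr_{I\sim\mathcal D}[I=i]\le\frac1\lambda\Pr_{I\sim\mathcal D_g}[I=i]$ for all $i\in\mathcal I$. Adaptive interaction: a multiset $S$ of $M$ i.i.d. samples from $\mathcal D$ is given to the mechanism $\mathcal M$ but not to the analyst. In each round $t=1,\dots,T$, the (possibly randomized) analyst chooses a query $q_t:\mathcal I\to\{-1,1\}$ as a function of the previous queries and answers $(q_1,a_1,\dots,q_{t-1},a_{t-1})$ and its own randomness; then $\mathcal M$, given $S$, the history, $q_t$ and its own randomness, outputs an answer $a_t\in\mathbb R$. The probability is over the sample and the randomness of both parties. The distribution $\mathcal D$ is unknown to $\mathcal M$. For the running time, queries are assumed to be evaluable at any given point in time polynomial in $n$. *)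

theory Defs
  imports
    "HOL-Probability.Probability"
    "HOL-Computational_Algebra.Polynomial"
    "HOL-Library.Monad_Syntax"
begin

section \<open>Dense distributions\<close>

definition dense_wrt :: "real \<Rightarrow> 'i set \<Rightarrow> 'i pmf \<Rightarrow> 'i pmf \<Rightarrow> bool" where
  "dense_wrt lam I D Dg \<longleftrightarrow> (\<forall>i\<in>I. pmf D i \<le> 1 / lam * pmf Dg i)"

definition bitstrings :: "nat \<Rightarrow> bool list set" where
  "bitstrings n = {x. length x = n}"

definition generated_dist :: "nat \<Rightarrow> (bool list \<Rightarrow> 'i) \<Rightarrow> 'i pmf" where
  "generated_dist n g = map_pmf g (pmf_of_set (bitstrings n))"

section \<open>The machine model\<close>

text \<open>
  Running times refer to a probabilistic imperative language over binary trees with integer leaves.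
  Unit-cost primitives are: constructing and destructing trees (which are passed by reference),
  integer addition, subtraction and comparison, a fair coin flip. There is no multiplication, so an
  integer gains at most one bit per step (beyond the constants of the program text), and the cost is
  polynomially related to Turing machine time.

  Iteration is by loops whose number of rounds is fixed on entry, so every program terminates. This
  is no restriction for polynomial time: a polynomial-time machine is simulated by nested loops that
  count up to its time bound. For the existence of a mechanism it only makes the claim stronger.
\<close>

datatype val = Atom int | Node val val

type_synonym store = "nat \<Rightarrow> val"

type_synonym query = "bool list \<Rightarrow> int"

datatype expr =
    Var nat
  | Const int
  | Plus expr expr
  | Minus expr expr
  | Less expr expr
  | Cons_of expr expr
  | Head expr
  | Tail expr
  | Is_Atom expr

datatype com =
    Skip
  | Assign nat expr
  | Seq com com
  | Cond expr com com
  | Loop expr com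
  | Flip nat
  | Query nat expr expr
  | Proc_Call nat com expr

fun int_of :: "val \<Rightarrow> int" where
  "int_of (Atom k) = k"
| "int_of (Node _ _) = 0"

fun head_of :: "val \<Rightarrow> val" where
  "head_of (Atom _) = Atom 0"
| "head_of (Node u _) = u"

fun tail_of :: "val \<Rightarrow> val" where
  "tail_of (Atom _) = Atom 0"
| "tail_of (Node _ v) = v"

fun is_atom :: "val \<Rightarrow> bool" where
  "is_atom (Atom _) = True"
| "is_atom (Node _ _) = False"

primrec eval_expr :: "expr \<Rightarrow> store \<Rightarrow> val" where
  "eval_expr (Var x) \<sigma> = \<sigma> x"
| "eval_expr (Const k) \<sigma> = Atom k"
| "eval_expr (Plus a b) \<sigma> = Atom (int_of (eval_expr a \<sigma>) + int_of (eval_expr b \<sigma>))"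
| "eval_expr (Minus a b) \<sigma> = Atom (int_of (eval_expr a \<sigma>) - int_of (eval_expr b \<sigma>))"
| "eval_expr (Less a b) \<sigma> = Atom (of_bool (int_of (eval_expr a \<sigma>) < int_of (eval_expr b \<sigma>)))"
| "eval_expr (Cons_of a b) \<sigma> = Node (eval_expr a \<sigma>) (eval_expr b \<sigma>)"
| "eval_expr (Head a) \<sigma> = head_of (eval_expr a \<sigma>)"
| "eval_expr (Tail a) \<sigma> = tail_of (eval_expr a \<sigma>)"
| "eval_expr (Is_Atom a) \<sigma> = Atom (of_bool (is_atom (eval_expr a \<sigma>)))"

primrec expr_cost :: "expr \<Rightarrow> nat" where
  "expr_cost (Var _) = 1"
| "expr_cost (Const _) = 1"
| "expr_cost (Plus a b) = expr_cost a + expr_cost b + 1"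
| "expr_cost (Minus a b) = expr_cost a + expr_cost b + 1"
| "expr_cost (Less a b) = expr_cost a + expr_cost b + 1"
| "expr_cost (Cons_of a b) = expr_cost a + expr_cost b + 1"
| "expr_cost (Head a) = expr_cost a + 1"
| "expr_cost (Tail a) = expr_cost a + 1"
| "expr_cost (Is_Atom a) = expr_cost a + 1"

fun enc_list :: "val list \<Rightarrow> val" where
  "enc_list [] = Atom 0"
| "enc_list (v # vs) = Node v (enc_list vs)"

definition enc_bits :: "bool list \<Rightarrow> val" where
  "enc_bits bs = enc_list (map (\<lambda>b. Atom (of_bool b)) bs)"

fun dec_bits :: "val \<Rightarrow> bool list" where
  "dec_bits (Atom _) = []"
| "dec_bits (Node u v) = (u \<noteq> Atom 0) # dec_bits v"

lemma dec_bits_enc_bits [simp]: "dec_bits (enc_bits bs) = bs"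
  by (induction bs) (auto simp: enc_bits_def)

primrec iterate_com ::
  "nat \<Rightarrow> (store \<Rightarrow> (store \<times> nat) pmf) \<Rightarrow> store \<Rightarrow> (store \<times> nat) pmf" where
  "iterate_com 0 f \<sigma> = return_pmf (\<sigma>, 0)"
| "iterate_com (Suc k) f \<sigma> = do {
     (\<sigma>1, t1) \<leftarrow> f \<sigma>;
     (\<sigma>2, t2) \<leftarrow> iterate_com k f \<sigma>1;
     return_pmf (\<sigma>2, 1 + t1 + t2)
   }"

text \<open>
  \<open>exec \<kappa> qs c \<sigma>\<close> is the joint distribution of final store and running time. The list \<open>qs\<close> contains
  the queries issued so far; \<open>Query y j e\<close> evaluates the \<open>j\<close>-th of them (counting from 0) at the
  point encoded by \<open>e\<close>, at a charge of \<open>\<kappa>\<close> time units. A procedure runs on a fresh store, with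
  argument and result in register 0.
\<close>

primrec exec :: "nat \<Rightarrow> query list \<Rightarrow> com \<Rightarrow> store \<Rightarrow> (store \<times> nat) pmf" where
  "exec \<kappa> qs Skip \<sigma> = return_pmf (\<sigma>, 1)"
| "exec \<kappa> qs (Assign y e) \<sigma> = return_pmf (\<sigma>(y := eval_expr e \<sigma>), 1 + expr_cost e)"
| "exec \<kappa> qs (Seq c1 c2) \<sigma> = do {
     (\<sigma>1, t1) \<leftarrow> exec \<kappa> qs c1 \<sigma>;
     (\<sigma>2, t2) \<leftarrow> exec \<kappa> qs c2 \<sigma>1;
     return_pmf (\<sigma>2, t1 + t2)
   }"
| "exec \<kappa> qs (Cond e c1 c2) \<sigma> = do {
     (\<sigma>', t) \<leftarrow> (if eval_expr e \<sigma> \<noteq> Atom 0 then exec \<kappa> qs c1 \<sigma> else exec \<kappa> qs c2 \<sigma>);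
     return_pmf (\<sigma>', 1 + expr_cost e + t)
   }"
| "exec \<kappa> qs (Loop e c) \<sigma> = do {
     (\<sigma>', t) \<leftarrow> iterate_com (nat (int_of (eval_expr e \<sigma>))) (exec \<kappa> qs c) \<sigma>;
     return_pmf (\<sigma>', 1 + expr_cost e + t)
   }"
| "exec \<kappa> qs (Flip y) \<sigma> =
     map_pmf (\<lambda>b. (\<sigma>(y := Atom (of_bool b)), 1)) (bernoulli_pmf (1 / 2))"
| "exec \<kappa> qs (Query y j e) \<sigma> = (
     let k = int_of (eval_expr j \<sigma>);
         r = (if 0 \<le> k \<and> k < int (length qs)
              then (qs ! nat k) (dec_bits (eval_expr e \<sigma>)) else 0)
     in return_pmf (\<sigma>(y := Atom r), 1 + expr_cost j + expr_cost e + \<kappa>))"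
| "exec \<kappa> qs (Proc_Call y c e) \<sigma> = do {
     (\<tau>, t) \<leftarrow> exec \<kappa> qs c ((\<lambda>_. Atom 0)(0 := eval_expr e \<sigma>));
     return_pmf (\<sigma>(y := \<tau> 0), 1 + expr_cost e + t)
   }"

primrec deterministic :: "com \<Rightarrow> bool" where
  "deterministic Skip \<longleftrightarrow> True"
| "deterministic (Assign y e) \<longleftrightarrow> True"
| "deterministic (Seq c1 c2) \<longleftrightarrow> deterministic c1 \<and> deterministic c2"
| "deterministic (Cond e c1 c2) \<longleftrightarrow> deterministic c1 \<and> deterministic c2"
| "deterministic (Loop e c) \<longleftrightarrow> deterministic c"
| "deterministic (Flip y) \<longleftrightarrow> False"
| "deterministic (Query y j e) \<longleftrightarrow> False"
| "deterministic (Proc_Call y c e) \<longleftrightarrow> deterministic c"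

text \<open>
  The single program \<open>c\<close> computes the whole family \<open>g\<close>: on input \<open>(n, x)\<close> in register 0 with
  \<open>x \<in> {0,1}\<^sup>n\<close> it leaves \<open>g n x\<close> in register 0 within \<open>\<tau> n\<close> steps. Query list and query charge are
  irrelevant for deterministic programs.
\<close>

definition computes_within ::
  "com \<Rightarrow> (nat \<Rightarrow> bool list \<Rightarrow> bool list) \<Rightarrow> (nat \<Rightarrow> nat) \<Rightarrow> bool" where
  "computes_within c g \<tau> \<longleftrightarrow> deterministic c \<and>
     (\<forall>n. \<forall>x\<in>bitstrings n. \<exists>\<sigma> t.
        exec 0 [] c ((\<lambda>_. Atom 0)(0 := Node (Atom (int n)) (enc_bits x))) = return_pmf (\<sigma>, t) \<and>
        \<sigma> 0 = enc_bits (g n x) \<and> t \<le> \<tau> n)"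

section \<open>Adaptive interaction\<close>

type_synonym history = "(query \<times> real) list"

text \<open>
  A randomized analyst is a behaviour strategy: it maps the previous queries and answers (oldest
  first) to the distribution of the next query. As the history records all of the analyst's own
  moves and everything it sees, private randomness kept between rounds is covered.
\<close>

type_synonym analyst = "history \<Rightarrow> query pmf"

definition valid_analyst :: "bool list set \<Rightarrow> analyst \<Rightarrow> bool" where
  "valid_analyst I A \<longleftrightarrow> (\<forall>h. \<forall>q\<in>set_pmf (A h). \<forall>i\<in>I. q i \<in> {-1, 1})"

text \<open>
  A mechanism is a program that is executed once per round, with a store that persists between the
  rounds. The real parameters \<open>lam\<close> and \<open>\<epsilon>\<close> are presented to it as the integers
  \<open>\<lceil>1 / lam\<rceil>\<close> and \<open>\<lceil>1 / \<epsilon>\<rceil>\<close>. Its answer is the rational number represented by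
  the pair of integers in register 6 at the end of the round.
\<close>

definition initial_store :: "nat \<Rightarrow> real \<Rightarrow> real \<Rightarrow> nat \<Rightarrow> bool list list \<Rightarrow> store" where
  "initial_store n lam \<epsilon> T S = (\<lambda>_. Atom 0)(
     0 := Atom (int n),
     1 := Atom \<lceil>1 / lam\<rceil>,
     2 := Atom \<lceil>1 / \<epsilon>\<rceil>,
     3 := Atom (int T),
     4 := Atom (int (length S)),
     5 := enc_list (map enc_bits S))"

definition answer_of :: "store \<Rightarrow> real" where
  "answer_of \<sigma> = real_of_int (int_of (head_of (\<sigma> 6))) / real_of_int (int_of (tail_of (\<sigma> 6)))"

text \<open>Joint distribution of the final history and the mechanism's total time over \<open>r\<close> further rounds.\<close>

primrec interact ::
  "nat \<Rightarrow> com \<Rightarrow> analyst \<Rightarrow> nat \<Rightarrow> store \<Rightarrow> history \<Rightarrow> (history \<times> nat) pmf" where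
  "interact \<kappa> c A 0 \<sigma> h = return_pmf (h, 0)"
| "interact \<kappa> c A (Suc r) \<sigma> h = do {
     q \<leftarrow> A h;
     (\<sigma>', t) \<leftarrow> exec \<kappa> (map fst h @ [q]) c \<sigma>;
     (h', t') \<leftarrow> interact \<kappa> c A r \<sigma>' (h @ [(q, answer_of \<sigma>')]);
     return_pmf (h', t + t')
   }"

definition adaptive_experiment ::
  "nat \<Rightarrow> com \<Rightarrow> nat \<Rightarrow> nat \<Rightarrow> real \<Rightarrow> real \<Rightarrow> nat \<Rightarrow> bool list pmf \<Rightarrow> analyst
     \<Rightarrow> (history \<times> nat) pmf" where
  "adaptive_experiment \<kappa> c M n lam \<epsilon> T D A = do {
     S \<leftarrow> replicate_pmf M D;
     interact \<kappa> c A T (initial_store n lam \<epsilon> T S) []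
   }"

definition accurate :: "real \<Rightarrow> bool list pmf \<Rightarrow> history \<Rightarrow> bool" where
  "accurate \<epsilon> D h \<longleftrightarrow>
     (\<forall>(q, a)\<in>set h. \<bar>a - measure_pmf.expectation D (\<lambda>k. real_of_int (q k))\<bar> \<le> \<epsilon>)"

end

theory Submission
  imports Defs
begin

section \<open>Answering adaptive queries on dense distributions\<close>

text \<open>
  With \<open>L = \<lceil>1 / lam\<rceil>\<close> and \<open>E = \<lceil>1 / \<epsilon>\<rceil>\<close>, the mechanism maintains a function \<open>h\<close> approximating the
  density of \<open>D\<close> with respect to \<open>D\<^sub>g\<close>, namely \<open>1 / (2 * E)\<close> times an integer combination of the past
  queries, clipped to \<open>[0, L]\<close>. It estimates the expectation of \<open>h * q\<close> under \<open>D\<^sub>g\<close> from fresh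
  seeds and compares it with the mean of \<open>q\<close> over the sample. The answer is the estimate plus
  \<open>k / (2 * E)\<close>, where \<open>k\<close> is the difference of the two in units of \<open>1 / (2 * E)\<close>, rounded towards 0, and
  \<open>q\<close> enters the combination with coefficient \<open>k\<close>.

  So the answers depend on the sample only through the integers \<open>k\<close>. As \<open>D\<close> has density at most \<open>L\<close>,
  a convex potential shows that the sum of all \<open>\<bar>k\<bar>\<close> is at most of the order of \<open>(L * E)\<^sup>2\<close> as long as
  sample means and estimates are accurate. A union bound over the possible sequences of
  coefficients, whose number is about \<open>T powr (L * E)\<^sup>2\<close>, then requires only
  \<open>E\<^sup>2 * (L * E)\<^sup>2 * ln T\<close> samples, up to constants.
\<close>

subsection \<open>Running programs\<close>

definition det_runs :: "nat \<Rightarrow> query list \<Rightarrow> com \<Rightarrow> store \<Rightarrow> (store \<Rightarrow> bool) \<Rightarrow> nat \<Rightarrow> bool" where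
  "det_runs \<kappa> qs c \<sigma> R b \<longleftrightarrow> (\<exists>\<sigma>' t. exec \<kappa> qs c \<sigma> = return_pmf (\<sigma>', t) \<and> R \<sigma>' \<and> t \<le> b)"

text \<open>A coupling of the run with an abstract outcome of law \<mu>, such as the seeds drawn. It
  lets the probabilistic analysis forget stores; the bound \<open>b\<close> holds on every
  run.\<close>

definition runs ::
  "nat \<Rightarrow> query list \<Rightarrow> com \<Rightarrow> store \<Rightarrow> 'v pmf \<Rightarrow> (store \<Rightarrow> 'v \<Rightarrow> bool) \<Rightarrow> nat \<Rightarrow> bool" where
  "runs \<kappa> qs c \<sigma> \<mu> R b \<longleftrightarrow> rel_pmf (\<lambda>(\<sigma>', t) v. R \<sigma>' v \<and> t \<le> b) (exec \<kappa> qs c \<sigma>) \<mu>"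

lemma det_runsI:
  "exec \<kappa> qs c \<sigma> = return_pmf (\<sigma>', t) \<Longrightarrow> R \<sigma>' \<Longrightarrow> t \<le> b \<Longrightarrow> det_runs \<kappa> qs c \<sigma> R b"
  unfolding det_runs_def by blast

lemma det_runs_seq:
  assumes "det_runs \<kappa> qs c1 \<sigma> R b1" and "\<And>\<sigma>'. R \<sigma>' \<Longrightarrow> det_runs \<kappa> qs c2 \<sigma>' R' b2"
  shows "det_runs \<kappa> qs (Seq c1 c2) \<sigma> R' (b1 + b2)"
proof -
  obtain \<sigma>1 t1 where 1: "exec \<kappa> qs c1 \<sigma> = return_pmf (\<sigma>1, t1)" "R \<sigma>1" "t1 \<le> b1"
    using assms(1) unfolding det_runs_def by blast
  obtain \<sigma>2 t2 where 2: "exec \<kappa> qs c2 \<sigma>1 = return_pmf (\<sigma>2, t2)" "R' \<sigma>2" "t2 \<le> b2"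
    using assms(2)[OF 1(2)] unfolding det_runs_def by blast
  show ?thesis
    by (rule det_runsI[of _ _ _ _ \<sigma>2 "t1 + t2"]) (use 1 2 in \<open>simp_all add: bind_return_pmf\<close>)
qed

lemma runs_det_seq:
  assumes "det_runs \<kappa> qs c1 \<sigma> R b1" and "\<And>\<sigma>'. R \<sigma>' \<Longrightarrow> runs \<kappa> qs c2 \<sigma>' \<mu> R' b2"
  shows "runs \<kappa> qs (Seq c1 c2) \<sigma> \<mu> R' (b1 + b2)"
proof -
  obtain \<sigma>1 t1 where 1: "exec \<kappa> qs c1 \<sigma> = return_pmf (\<sigma>1, t1)" "R \<sigma>1" "t1 \<le> b1"
    using assms(1) unfolding det_runs_def by blast
  \<comment> \<open>Writing \<mu> as \<open>\<mu> \<bind> return_pmf\<close> gives both sides of the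
    coupling the shape of a bind.\<close>
  have "rel_pmf (\<lambda>(\<sigma>', t) v. R' \<sigma>' v \<and> t \<le> b1 + b2)
      (exec \<kappa> qs c2 \<sigma>1 \<bind> (\<lambda>(\<sigma>2, t2). return_pmf (\<sigma>2, t1 + t2))) (\<mu> \<bind> return_pmf)"
    by (rule rel_pmf_bindI[OF assms(2)[OF 1(2), unfolded runs_def]]) (use 1(3) in auto)
  then show ?thesis
    by (simp add: runs_def 1(1) bind_return_pmf bind_return_pmf')
qed

lemma runs_seq_det:
  assumes "runs \<kappa> qs c1 \<sigma> \<mu> R b1"
    and "\<And>\<sigma>' v. R \<sigma>' v \<Longrightarrow> det_runs \<kappa> qs c2 \<sigma>' (\<lambda>\<sigma>''. R' \<sigma>'' v) b2"
  shows "runs \<kappa> qs (Seq c1 c2) \<sigma> \<mu> R' (b1 + b2)"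
proof -
  have "rel_pmf (\<lambda>(\<sigma>', t) v. R' \<sigma>' v \<and> t \<le> b1 + b2)
      (exec \<kappa> qs (Seq c1 c2) \<sigma>) (\<mu> \<bind> return_pmf)"
    unfolding exec.simps
  proof (rule rel_pmf_bindI[OF assms(1)[unfolded runs_def]], clarify)
    fix \<sigma>1 t1 v assume "R \<sigma>1 v" "t1 \<le> b1"
    then show "rel_pmf (\<lambda>(\<sigma>', t) v. R' \<sigma>' v \<and> t \<le> b1 + b2)
      (exec \<kappa> qs c2 \<sigma>1 \<bind> (\<lambda>(\<sigma>2, t2). return_pmf (\<sigma>2, t1 + t2))) (return_pmf v)"
      using assms(2)[of \<sigma>1 v] by (auto simp: det_runs_def bind_return_pmf)
  qed
  then show ?thesis by (simp add: runs_def bind_return_pmf')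
qed

lemma runs_mono:
  assumes "runs \<kappa> qs c \<sigma> \<mu> R b" "\<And>\<sigma>' v. R \<sigma>' v \<Longrightarrow> R' \<sigma>' v" "b \<le> b'"
  shows "runs \<kappa> qs c \<sigma> \<mu> R' b'"
  using assms(1) unfolding runs_def
  by (rule pmf.rel_mono_strong) (use assms(2,3) in auto)

text \<open>A deterministic program contains no \<open>Query\<close>. This carries
  \<open>computes_within\<close>, stated for the empty query list and charge 0, over to calls made
  in any round.\<close>

lemma exec_deterministic_cong:
  "deterministic c \<Longrightarrow> exec \<kappa> qs c \<sigma> = exec \<kappa>' qs' c \<sigma>"
proof (induction c arbitrary: \<sigma>)
  case (Loop e c)
  then have "exec \<kappa> qs c = exec \<kappa>' qs' c" by auto
  then show ?case by simp
qed auto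

text \<open>\<open>draw_bits\<close> puts each new coin in front, so the seed is the reversed coin
  sequence; uniformity survives the reversal.\<close>

lemma map_rev_replicate_coin:
  "map_pmf rev (replicate_pmf n (bernoulli_pmf (1/2))) = pmf_of_set (bitstrings n)"
proof -
  have fin: "finite (bitstrings n)" for n
    using finite_lists_length_eq[of "UNIV :: bool set" n] by (simp add: bitstrings_def)
  have ne: "bitstrings n \<noteq> {}" for n
    by (auto simp: bitstrings_def intro: exI[of _ "replicate n True"])
  have cd: "card (bitstrings n) = 2 ^ n" for n
    using card_lists_length_eq[of "UNIV :: bool set" n] by (simp add: bitstrings_def)
  have "replicate_pmf n (bernoulli_pmf (1/2)) = pmf_of_set (bitstrings n)"
  proof (induction n)
    case 0
    have "bitstrings 0 = {[]}" by (auto simp: bitstrings_def)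
    then show ?case by (simp add: pmf_of_set_singleton)
  next
    case (Suc n)
    have "replicate_pmf (Suc n) (bernoulli_pmf (1/2)) =
        map_pmf (\<lambda>(x, xs). x # xs) (pair_pmf (pmf_of_set UNIV) (pmf_of_set (bitstrings n)))"
      by (simp add: Suc flip: bernoulli_pmf_half_conv_pmf_of_set)
        (simp add: pair_pmf_def map_bind_pmf)
    also have "\<dots> = map_pmf (\<lambda>(x, xs). x # xs) (pmf_of_set (UNIV \<times> bitstrings n))"
      using fin ne by (intro arg_cong[where f = "map_pmf _"] pmf_eqI)
        (auto simp: pmf_pair pmf_of_set card_cartesian_product indicator_def)
    also have "\<dots> = pmf_of_set ((\<lambda>(x, xs). x # xs) ` (UNIV \<times> bitstrings n))"
      by (rule map_pmf_of_set_inj) (use fin ne in \<open>auto simp: inj_on_def\<close>)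
    also have "(\<lambda>(x, xs). x # xs) ` (UNIV \<times> bitstrings n) = bitstrings (Suc n)"
      by (auto simp: bitstrings_def length_Suc_conv image_iff)
    finally show ?case .
  qed
  moreover have "map_pmf rev (pmf_of_set (bitstrings n)) = pmf_of_set (rev ` bitstrings n)"
    by (rule map_pmf_of_set_inj) (use fin ne in auto)
  moreover have "rev ` bitstrings n = bitstrings n"
    by (auto simp: bitstrings_def image_iff intro!: exI[of _ "rev _"])
  ultimately show ?thesis by simp
qed

subsection \<open>The mechanism\<close>

text \<open>
  Registers 0 to 5 keep the input and register 6 the answer. Register 7 holds the coefficients
  \<open>k\<close> of the past rounds, latest first, and register 8 the number of past rounds, which is the
  index of the current query. In a round, 10 is the list of samples still to be read, 11 the seed,
  12 a coin, 13 the point \<open>g x\<close>, 14 to 16 the evaluation of the hypothesis at this point, 17 a query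
  value, and 19 to 22 hold the clipping bound, the scaled sample sum, the denominator of the answer
  and the hypothesis sum. Finally 9 and 18 are remainder and quotient of the difference of
  the two sums by the sample size.
\<close>

definition draw_bits :: com where
  "draw_bits = Seq (Assign 11 (Const 0))
     (Loop (Var 0) (Seq (Flip 12) (Assign 11 (Cons_of (Var 12) (Var 11)))))"

text \<open>The accumulator \<open>acc\<close> stands for the coins drawn so far. A coin costs 5
  steps, and the loop adds 1.\<close>

lemma iterate_draw:
  assumes "\<sigma> 11 = enc_bits acc"
  shows "rel_pmf (\<lambda>(\<sigma>', t) bs. (\<sigma>' 11 = enc_bits (rev bs @ acc) \<and>
             (\<forall>r. r \<notin> {11, 12} \<longrightarrow> \<sigma>' r = \<sigma> r)) \<and> t \<le> 6 * n)
           (iterate_com n (exec \<kappa> qs (Seq (Flip 12) (Assign 11 (Cons_of (Var 12) (Var 11))))) \<sigma>)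
           (replicate_pmf n (bernoulli_pmf (1/2)))"
  using assms
proof (induction n arbitrary: \<sigma> acc)
  case 0
  then show ?case by simp
next
  case (Suc n)
  let ?f = "exec \<kappa> qs (Seq (Flip 12) (Assign 11 (Cons_of (Var 12) (Var 11))))"
  have f: "?f \<sigma> = bernoulli_pmf (1/2) \<bind>
      (\<lambda>b. return_pmf (\<sigma>(12 := Atom (of_bool b), 11 := Node (Atom (of_bool b)) (\<sigma> 11)), 5))"
    by (simp add: map_pmf_def bind_assoc_pmf bind_return_pmf numeral_eq_Suc)
  show ?case
    unfolding iterate_com.simps replicate_pmf.simps f bind_assoc_pmf
  proof (rule rel_pmf_bindI[where R = "(=)"])
    fix b b' :: bool assume "b = b'"
    let ?\<sigma> = "\<sigma>(12 := Atom (of_bool b), 11 := Node (Atom (of_bool b)) (\<sigma> 11))"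
    have s: "?\<sigma> 11 = enc_bits (b # acc)"
      using Suc.prems by (simp add: enc_bits_def)
    show "rel_pmf (\<lambda>(\<sigma>', t) bs. (\<sigma>' 11 = enc_bits (rev bs @ acc) \<and>
             (\<forall>r. r \<notin> {11, 12} \<longrightarrow> \<sigma>' r = \<sigma> r)) \<and> t \<le> 6 * Suc n)
          (return_pmf (?\<sigma>, 5) \<bind> (\<lambda>(\<sigma>1, t1). iterate_com n ?f \<sigma>1 \<bind>
             (\<lambda>(\<sigma>2, t2). return_pmf (\<sigma>2, 1 + t1 + t2))))
          (replicate_pmf n (bernoulli_pmf (1/2)) \<bind> (\<lambda>xs. return_pmf (b' # xs)))"
      unfolding bind_return_pmf prod.case
      by (rule rel_pmf_bindI[OF Suc.IH[where \<sigma> = ?\<sigma> and acc = "b # acc", OF s]]) (auto simp: \<open>b = b'\<close>)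
  qed (simp add: pmf.rel_eq)
qed

lemma runs_draw_bits:
  assumes "\<sigma> 0 = Atom (int n)"
  shows "runs \<kappa> qs draw_bits \<sigma> (pmf_of_set (bitstrings n))
    (\<lambda>\<sigma>' x. \<sigma>' 11 = enc_bits x \<and> (\<forall>r. r \<notin> {11, 12} \<longrightarrow> \<sigma>' r = \<sigma> r)) (6 * n + 4)"
proof -
  let ?f = "exec \<kappa> qs (Seq (Flip 12) (Assign 11 (Cons_of (Var 12) (Var 11))))"
  have 1: "exec \<kappa> qs draw_bits \<sigma> = iterate_com n ?f (\<sigma>(11 := Atom 0)) \<bind>
      (\<lambda>(\<sigma>', t). return_pmf (\<sigma>', 4 + t))"
    by (simp add: draw_bits_def assms bind_return_pmf bind_assoc_pmf case_prod_unfold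
        numeral_eq_Suc del: exec.simps(6))
  have s: "(\<sigma>(11 := Atom 0)) 11 = enc_bits []" by (simp add: enc_bits_def)
  have "rel_pmf (\<lambda>(\<sigma>', t) x. (\<sigma>' 11 = enc_bits x \<and> (\<forall>r. r \<notin> {11, 12} \<longrightarrow> \<sigma>' r = \<sigma> r))
             \<and> t \<le> 6 * n + 4) (exec \<kappa> qs draw_bits \<sigma>)
      (replicate_pmf n (bernoulli_pmf (1/2)) \<bind> (\<lambda>bs. return_pmf (rev bs)))"
    unfolding 1 by (rule rel_pmf_bindI[OF iterate_draw[where \<sigma> = "\<sigma>(11 := Atom 0)" and acc = "[]", OF s]]) auto
  then show ?thesis
    by (simp add: runs_def map_rev_replicate_coin flip: map_pmf_def)
qed


text \<open>The programs only test whether a query value is positive. \<open>sgnq\<close> agrees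
  with a valid query on \<open>I\<close> and stays bounded elsewhere, where a query may return any
  integer.\<close>

definition sgnq :: "query \<Rightarrow> bool list \<Rightarrow> int" where
  "sgnq q i = (if 0 < q i then 1 else - 1)"

text \<open>The latest coefficient is first, so the query that belongs to \<open>k\<close> has index \<open>length ks\<close>.\<close>

primrec score :: "query list \<Rightarrow> int list \<Rightarrow> bool list \<Rightarrow> int" where
  "score qs [] i = 0"
| "score qs (k # ks) i = k * sgnq (qs ! length ks) i + score qs ks i"

lemma score_append:
  "length ks \<le> length qs \<Longrightarrow> score (qs @ qs') ks i = score qs ks i"
  by (induction ks) (auto simp: nth_append)

definition hyp :: "int \<Rightarrow> query list \<Rightarrow> int list \<Rightarrow> bool list \<Rightarrow> int" where
  "hyp cap qs ks i = max 0 (min cap (score qs ks i))"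

text \<open>Register 16 is decremented before the query, so that it holds the number of coefficients
  behind the current one, which is the index of the query belonging to it.\<close>

definition score_step :: com where
  "score_step =
     Seq (Assign 16 (Minus (Var 16) (Const 1)))
    (Seq (Query 17 (Var 16) (Var 13))
    (Seq (Cond (Less (Const 0) (Var 17))
            (Assign 14 (Plus (Var 14) (Head (Var 15))))
            (Assign 14 (Minus (Var 14) (Head (Var 15)))))
         (Assign 15 (Tail (Var 15)))))"

definition eval_hyp :: com where
  "eval_hyp =
     Seq (Assign 14 (Const 0))
    (Seq (Assign 15 (Var 7))
    (Seq (Assign 16 (Var 8))
    (Seq (Loop (Var 8) score_step)
    (Seq (Cond (Less (Var 19) (Var 14)) (Assign 14 (Var 19)) Skip)
         (Cond (Less (Var 14) (Const 0)) (Assign 14 (Const 0)) Skip)))))"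

lemma exec_score_step:
  assumes "\<sigma> 13 = enc_bits y" "\<sigma> 14 = Atom u" "\<sigma> 15 = enc_list (map Atom (k # ks))"
    "\<sigma> 16 = Atom (int (Suc (length ks)))" "length ks < length qs"
  shows "\<exists>t \<le> 24 + \<kappa>. exec \<kappa> qs score_step \<sigma> = return_pmf
    (\<sigma>(16 := Atom (int (length ks)), 17 := Atom ((qs ! length ks) y),
       14 := Atom (u + k * sgnq (qs ! length ks) y), 15 := enc_list (map Atom ks)), t)"
  using assms
  by (simp add: score_step_def bind_return_pmf sgnq_def fun_upd_twist Let_def)

lemma iterate_score_step:
  assumes "\<sigma> 13 = enc_bits y" "\<sigma> 14 = Atom u" "\<sigma> 15 = enc_list (map Atom ks)"
    "\<sigma> 16 = Atom (int (length ks))" "length ks \<le> length qs"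
  shows "\<exists>\<sigma>' t. iterate_com (length ks) (exec \<kappa> qs score_step) \<sigma> = return_pmf (\<sigma>', t) \<and>
    \<sigma>' 14 = Atom (u + score qs ks y) \<and> (\<forall>r. r \<notin> {14,15,16,17} \<longrightarrow> \<sigma>' r = \<sigma> r) \<and>
    t \<le> length ks * (25 + \<kappa>)"
  using assms
proof (induction ks arbitrary: \<sigma> u)
  case Nil
  then show ?case by simp
next
  case (Cons k ks)
  define \<sigma>1 where "\<sigma>1 = \<sigma>(16 := Atom (int (length ks)), 17 := Atom ((qs ! length ks) y),
       14 := Atom (u + k * sgnq (qs ! length ks) y), 15 := enc_list (map Atom ks))"
  obtain t where t: "t \<le> 24 + \<kappa>" "exec \<kappa> qs score_step \<sigma> = return_pmf (\<sigma>1, t)"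
    unfolding \<sigma>1_def using exec_score_step[of \<sigma> y u k ks qs \<kappa>] Cons.prems by auto
  have "\<exists>\<sigma>' t. iterate_com (length ks) (exec \<kappa> qs score_step) \<sigma>1 = return_pmf (\<sigma>', t) \<and>
    \<sigma>' 14 = Atom (u + k * sgnq (qs ! length ks) y + score qs ks y) \<and>
    (\<forall>r. r \<notin> {14,15,16,17} \<longrightarrow> \<sigma>' r = \<sigma>1 r) \<and> t \<le> length ks * (25 + \<kappa>)"
    by (rule Cons.IH) (use Cons.prems in \<open>auto simp: \<sigma>1_def\<close>)
  then obtain \<sigma>' t' where "iterate_com (length ks) (exec \<kappa> qs score_step) \<sigma>1 = return_pmf (\<sigma>', t')"
    "\<sigma>' 14 = Atom (u + k * sgnq (qs ! length ks) y + score qs ks y)"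
    "\<forall>r. r \<notin> {14,15,16,17} \<longrightarrow> \<sigma>' r = \<sigma>1 r"
    "t' \<le> length ks * (25 + \<kappa>)" by blast
  with t show ?case
    by (intro exI[of _ \<sigma>'] exI[of _ "1 + t + t'"])
       (auto simp: bind_return_pmf algebra_simps \<sigma>1_def)
qed

lemma det_runs_eval_hyp:
  assumes "\<sigma> 13 = enc_bits y" "\<sigma> 7 = enc_list (map Atom ks)" "\<sigma> 8 = Atom (int (length ks))"
    "\<sigma> 19 = Atom cap" "length ks \<le> length qs" "0 \<le> cap"
  shows "det_runs \<kappa> qs eval_hyp \<sigma> (\<lambda>\<sigma>'. \<sigma>' 14 = Atom (hyp cap qs ks y) \<and>
     (\<forall>r. r \<notin> {14,15,16,17} \<longrightarrow> \<sigma>' r = \<sigma> r)) (30 + length ks * (25 + \<kappa>))"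
proof -
  let ?\<sigma> = "\<sigma>(14 := Atom 0, 15 := enc_list (map Atom ks), 16 := Atom (int (length ks)))"
  obtain \<sigma>' t where *: "iterate_com (length ks) (exec \<kappa> qs score_step) ?\<sigma> = return_pmf (\<sigma>', t)"
    "\<sigma>' 14 = Atom (score qs ks y)"
    "\<forall>r. r \<notin> {14,15,16,17} \<longrightarrow> \<sigma>' r = ?\<sigma> r"
    "t \<le> length ks * (25 + \<kappa>)"
    using iterate_score_step[of ?\<sigma> y 0 ks qs \<kappa>] assms by auto
  then have "\<sigma>' 19 = Atom cap" using assms by simp
  then show ?thesis
    using * assms unfolding det_runs_def eval_hyp_def
    by (auto simp: bind_return_pmf hyp_def)
qed


text \<open>Hands facts about the support of \<mu>, such as the length of a seed, to the program
  that follows.\<close>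

lemma runs_support:
  assumes "runs \<kappa> qs c \<sigma> \<mu> R b"
  shows "runs \<kappa> qs c \<sigma> \<mu> (\<lambda>\<sigma>' v. R \<sigma>' v \<and> v \<in> set_pmf \<mu>) b"
  using assms unfolding runs_def by (rule pmf.rel_mono_strong) auto

text \<open>Sums are kept in units of \<open>1 / (2 * E)\<close>, with \<open>E\<close> in register
  2. Adding \<open>2 * E\<close> per sample point builds the scaled sum and the denominator without
  multiplication.\<close>

definition sample_pre :: com where
  "sample_pre =
     Seq (Query 17 (Var 8) (Head (Var 10)))
    (Seq (Assign 10 (Tail (Var 10)))
    (Seq (Cond (Less (Const 0) (Var 17))
            (Assign 20 (Plus (Var 20) (Plus (Var 2) (Var 2))))
            (Assign 20 (Minus (Var 20) (Plus (Var 2) (Var 2)))))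
         (Assign 21 (Plus (Var 21) (Plus (Var 2) (Var 2))))))"

definition sample_post :: "com \<Rightarrow> com" where
  "sample_post gprog =
     Seq (Proc_Call 13 gprog (Cons_of (Var 0) (Var 11)))
    (Seq eval_hyp
    (Seq (Query 17 (Var 8) (Var 13))
         (Cond (Less (Const 0) (Var 17))
            (Assign 22 (Plus (Var 22) (Var 14)))
            (Assign 22 (Minus (Var 22) (Var 14))))))"

definition sample_step :: "com \<Rightarrow> com" where
  "sample_step gprog = Seq sample_pre (Seq draw_bits (sample_post gprog))"

text \<open>Division rounding towards 0; the estimate of the potential fails for rounding to the nearest integer.\<close>

definition quot0 :: "int \<Rightarrow> int \<Rightarrow> int" where
  "quot0 d m = sgn d * (\<bar>d\<bar> div m)"

text \<open>One round of division by repeated subtraction, from either sign towards 0. It is idle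
  once the remainder is smaller than the sample size, so surplus rounds do no harm.\<close>

definition shave :: com where
  "shave =
     Cond (Less (Var 9) (Var 4))
       (Cond (Less (Minus (Const 0) (Var 4)) (Var 9)) Skip
          (Seq (Assign 9 (Plus (Var 9) (Var 4))) (Assign 18 (Minus (Var 18) (Const 1)))))
       (Seq (Assign 9 (Minus (Var 9) (Var 4))) (Assign 18 (Plus (Var 18) (Const 1))))"

definition add_cap :: com where
  "add_cap = Assign 19 (Plus (Var 19) (Plus (Var 2) (Var 2)))"

text \<open>The quotient is at most \<open>2 * E\<close> plus the clipping bound in register 19,
  which fixes the number of \<open>shave\<close> rounds. The numerator of the answer, hypothesis sum
  plus quotient times sample size, is obtained as sample sum minus remainder.\<close>

definition round_prog :: "com \<Rightarrow> com" where
  "round_prog gprog =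
    Seq (Seq (Assign 19 (Const 0)) (Seq (Loop (Var 1) add_cap)
    (Seq (Assign 20 (Const 0)) (Seq (Assign 21 (Const 0)) (Seq (Assign 22 (Const 0))
         (Assign 10 (Var 5)))))))
    (Seq (Loop (Var 4) (sample_step gprog))
    (Seq (Assign 9 (Minus (Var 20) (Var 22)))
    (Seq (Assign 18 (Const 0))
    (Seq (Loop (Plus (Plus (Var 2) (Var 2)) (Var 19)) shave)
    (Seq (Assign 6 (Cons_of (Minus (Var 20) (Var 9)) (Var 21)))
    (Seq (Assign 7 (Cons_of (Var 18) (Var 7)))
         (Assign 8 (Plus (Var 8) (Const 1)))))))))"

lemma quot0_small: "\<bar>d\<bar> < m \<Longrightarrow> quot0 d m = 0"
  by (simp add: quot0_def)

lemma quot0_minus: "quot0 (- d) m = - quot0 d m"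
  by (simp add: quot0_def sgn_minus)

lemma quot0_step:
  assumes "0 < m" "m \<le> d"
  shows "quot0 d m = 1 + quot0 (d - m) m"
proof -
  have "d div m = 1 + (d - m) div m"
    using div_add_self1[of m "d - m"] assms by simp
  then show ?thesis using assms by (cases "d = m") (auto simp: quot0_def)
qed

text \<open>\<open>N\<close> rounds complete the division when the quotient has absolute value at
  most \<open>N\<close>, which is the last assumption.\<close>

lemma iterate_shave:
  assumes "\<sigma> 9 = Atom d" "\<sigma> 18 = Atom k" "\<sigma> 4 = Atom m" "0 < m" "\<bar>d\<bar> < int (Suc N) * m"
  shows "\<exists>\<sigma>' t. iterate_com N (exec \<kappa> qs shave) \<sigma> = return_pmf (\<sigma>', t) \<and>
    \<sigma>' 9 = Atom (d - quot0 d m * m) \<and> \<sigma>' 18 = Atom (k + quot0 d m) \<and>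
    (\<forall>r. r \<notin> {9,18} \<longrightarrow> \<sigma>' r = \<sigma> r) \<and> t \<le> N * 30"
  using assms
proof (induction N arbitrary: \<sigma> d k)
  case 0
  then show ?case by (auto simp: quot0_small)
next
  case (Suc N)
  consider "m \<le> d" | "d \<le> - m" | "- m < d" "d < m" by linarith
  then obtain d1 k1 where dk: "m \<le> d \<and> d1 = d - m \<and> k1 = k + 1 \<or> d \<le> - m \<and> d1 = d + m \<and> k1 = k - 1 \<or>
       - m < d \<and> d < m \<and> d1 = d \<and> k1 = k"
    by cases auto
  have q: "quot0 d m + k = quot0 d1 m + k1"
  proof -
    consider "m \<le> d" "d1 = d - m" "k1 = k + 1" | "d \<le> - m" "d1 = d + m" "k1 = k - 1" |
      "d1 = d" "k1 = k" using dk by blast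
    then show ?thesis
    proof cases
      case 2
      then show ?thesis
        using quot0_step[of m "- d"] Suc.prems(4) quot0_minus[of d m] quot0_minus[of "d + m" m]
        by (simp add: algebra_simps)
    qed (use quot0_step[of m d] Suc.prems(4) in auto)
  qed
  \<comment> \<open>Each round preserves \<open>d + k * m\<close>.\<close>
  have dm: "d - d1 = (k1 - k) * m"
    using dk by (auto simp: algebra_simps)
  define \<sigma>1 where "\<sigma>1 = \<sigma>(9 := Atom d1, 18 := Atom k1)"
  have fu: "\<sigma>(9 := Atom d, 18 := Atom k) = \<sigma>" using Suc.prems by auto
  have "\<exists>t\<le>29. exec \<kappa> qs shave \<sigma> = return_pmf (\<sigma>1, t)"
    using dk Suc.prems(1-4) fu unfolding \<sigma>1_def shave_def
    by (auto simp: bind_return_pmf)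
  then obtain t where t: "t \<le> 29" "exec \<kappa> qs shave \<sigma> = return_pmf (\<sigma>1, t)" by blast
  have "0 \<le> int N * m" using Suc.prems by simp
  then have d1: "\<bar>d1\<bar> < int (Suc N) * m"
    using dk Suc.prems(4,5) unfolding of_nat_Suc distrib_right mult_1
    by (elim disjE conjE) linarith+
  have "\<exists>\<sigma>' t. iterate_com N (exec \<kappa> qs shave) \<sigma>1 = return_pmf (\<sigma>', t) \<and>
    \<sigma>' 9 = Atom (d1 - quot0 d1 m * m) \<and> \<sigma>' 18 = Atom (k1 + quot0 d1 m) \<and>
    (\<forall>r. r \<notin> {9,18} \<longrightarrow> \<sigma>' r = \<sigma>1 r) \<and> t \<le> N * 30"
    by (rule Suc.IH) (use Suc.prems d1 in \<open>auto simp: \<sigma>1_def\<close>)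
  then obtain \<sigma>' t' where *: "iterate_com N (exec \<kappa> qs shave) \<sigma>1 = return_pmf (\<sigma>', t')"
    "\<sigma>' 9 = Atom (d1 - quot0 d1 m * m)" "\<sigma>' 18 = Atom (k1 + quot0 d1 m)"
    "\<forall>r. r \<notin> {9,18} \<longrightarrow> \<sigma>' r = \<sigma>1 r" "t' \<le> N * 30"
    by blast
  have "d1 - quot0 d1 m * m = d - quot0 d m * m" "k1 + quot0 d1 m = k + quot0 d m"
    using q dm by algebra+
  with t * show ?case
    by (intro exI[of _ \<sigma>'] exI[of _ "1 + t + t'"])
       (auto simp: bind_return_pmf \<sigma>1_def)
qed

lemma iterate_add_cap:
  assumes "\<sigma> 19 = Atom c" "\<sigma> 2 = Atom e"
  shows "\<exists>t. iterate_com N (exec \<kappa> qs add_cap) \<sigma> = return_pmf (\<sigma>(19 := Atom (c + int N * (2 * e))), t) \<and>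
    t \<le> N * 10"
  using assms
proof (induction N arbitrary: \<sigma> c)
  case 0
  then show ?case by (auto simp: fun_upd_idem)
next
  case (Suc N)
  have "\<exists>t. iterate_com N (exec \<kappa> qs add_cap) (\<sigma>(19 := Atom (c + 2 * e))) =
      return_pmf (\<sigma>(19 := Atom (c + 2 * e), 19 := Atom (c + 2 * e + int N * (2 * e))), t) \<and> t \<le> N * 10"
    by (rule Suc.IH) (use Suc.prems in auto)
  moreover have "exec \<kappa> qs add_cap \<sigma> = return_pmf (\<sigma>(19 := Atom (c + 2 * e)), 6)"
    using Suc.prems by (simp add: add_cap_def)
  ultimately show ?case
    by (auto simp: bind_return_pmf algebra_simps fun_eq_iff)
qed


lemma abs_sum_list_le:
  fixes f :: "'b \<Rightarrow> int"
  assumes "\<And>x. \<bar>f x\<bar> \<le> c"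
  shows "\<bar>\<Sum>x\<leftarrow>xs. f x\<bar> \<le> c * int (length xs)"
proof (induction xs)
  case (Cons x xs)
  then show ?case using assms[of x] by (simp add: algebra_simps)
qed simp

lemma abs_sgnq: "\<bar>sgnq q i\<bar> = 1"
  by (simp add: sgnq_def)

section \<open>Correctness and cost of one round\<close>

locale generator =
  fixes n :: nat and g :: "nat \<Rightarrow> bool list \<Rightarrow> bool list" and gprog :: com and \<tau> :: "nat \<Rightarrow> nat"
    and L E :: int
  assumes gprog: "computes_within gprog g \<tau>" and L_pos: "0 < L" and E_pos: "0 < E"
begin

text \<open>The density bound \<open>L\<close> in units of \<open>1 / (2 * E)\<close>.\<close>

definition cap :: int where
  "cap = 2 * E * L"

lemma cap_pos: "0 < cap"
  using L_pos E_pos by (simp add: cap_def)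

abbreviation seeds :: "bool list pmf" where
  "seeds \<equiv> pmf_of_set (bitstrings n)"

definition hyp_sum :: "query list \<Rightarrow> int list \<Rightarrow> query \<Rightarrow> bool list list \<Rightarrow> int" where
  "hyp_sum qs ks q xs = (\<Sum>x\<leftarrow>xs. hyp cap qs ks (g n x) * sgnq q (g n x))"

definition sample_sum :: "query \<Rightarrow> bool list list \<Rightarrow> int" where
  "sample_sum q S = 2 * E * (\<Sum>s\<leftarrow>S. sgnq q s)"

lemma hyp_bounds: "0 \<le> hyp cap qs ks i" "hyp cap qs ks i \<le> cap"
  using cap_pos by (auto simp: hyp_def)

lemma exec_gprog:
  assumes "x \<in> bitstrings n"
  shows "\<exists>\<sigma> t. exec \<kappa> qs gprog ((\<lambda>_. Atom 0)(0 := Node (Atom (int n)) (enc_bits x))) = return_pmf (\<sigma>, t)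
    \<and> \<sigma> 0 = enc_bits (g n x) \<and> t \<le> \<tau> n"
  using gprog assms exec_deterministic_cong[of gprog \<kappa> qs _ 0 "[]"]
  unfolding computes_within_def by metis

definition step_bound :: "nat \<Rightarrow> nat \<Rightarrow> nat" where
  "step_bound \<kappa> t = 100 + 6 * n + \<tau> n + t * (25 + \<kappa>) + 2 * \<kappa>"

lemma runs_sample_step:
  assumes "\<sigma> 0 = Atom (int n)" "\<sigma> 2 = Atom E" "\<sigma> 7 = enc_list (map Atom ks)"
    "\<sigma> 8 = Atom (int (length ks))" "\<sigma> 19 = Atom cap" "length ks < length qs"
    "\<sigma> 10 = enc_list (map enc_bits (s # S))"
    "\<sigma> 20 = Atom a" "\<sigma> 21 = Atom e" "\<sigma> 22 = Atom b" and q: "q = qs ! length ks"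
  shows "runs \<kappa> qs (sample_step gprog) \<sigma> seeds
    (\<lambda>\<sigma>' x. \<sigma>' 10 = enc_list (map enc_bits S) \<and> \<sigma>' 20 = Atom (a + 2 * E * sgnq q s) \<and>
       \<sigma>' 21 = Atom (e + 2 * E) \<and> \<sigma>' 22 = Atom (b + hyp cap qs ks (g n x) * sgnq q (g n x)) \<and>
       (\<forall>r. r < 9 \<or> r = 19 \<longrightarrow> \<sigma>' r = \<sigma> r)) (step_bound \<kappa> (length ks))"
proof -
  define R1 where "R1 = (\<lambda>\<sigma>'. \<sigma>' 10 = enc_list (map enc_bits S) \<and>
       \<sigma>' 20 = Atom (a + 2 * E * sgnq q s) \<and> \<sigma>' 21 = Atom (e + 2 * E) \<and> \<sigma>' 22 = Atom b \<and>
       (\<forall>r. r < 9 \<or> r = 19 \<longrightarrow> \<sigma>' r = \<sigma> r))"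
  have 1: "det_runs \<kappa> qs sample_pre \<sigma> R1 (30 + \<kappa>)"
    using assms unfolding det_runs_def sample_pre_def R1_def
    by (auto simp: bind_return_pmf Let_def sgnq_def)
  have 2: "runs \<kappa> qs (Seq draw_bits (sample_post gprog)) \<sigma>1 seeds
    (\<lambda>\<sigma>' x. \<sigma>' 10 = enc_list (map enc_bits S) \<and> \<sigma>' 20 = Atom (a + 2 * E * sgnq q s) \<and>
       \<sigma>' 21 = Atom (e + 2 * E) \<and> \<sigma>' 22 = Atom (b + hyp cap qs ks (g n x) * sgnq q (g n x)) \<and>
       (\<forall>r. r < 9 \<or> r = 19 \<longrightarrow> \<sigma>' r = \<sigma> r))
    ((6 * n + 4) + ((10 + \<tau> n) + ((30 + length ks * (25 + \<kappa>)) + (20 + \<kappa>))))"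
    if R1: "R1 \<sigma>1" for \<sigma>1
  proof (rule runs_seq_det[OF runs_support[OF runs_draw_bits]], goal_cases)
    case 1
    show ?case using R1 assms(1) by (simp add: R1_def)
  next
    case (2 \<sigma>2 x)
    note s2 = this
    then have "x \<in> bitstrings n"
      using finite_lists_length_eq[of "UNIV :: bool set" n]
      by (subst (asm) set_pmf_of_set)
         (auto simp: bitstrings_def intro: exI[of _ "replicate n True"])
    then obtain \<rho> t where \<rho>: "exec \<kappa> qs gprog ((\<lambda>_. Atom 0)(0 := Node (Atom (int n)) (enc_bits x)))
        = return_pmf (\<rho>, t)" "\<rho> 0 = enc_bits (g n x)" "t \<le> \<tau> n"
      using exec_gprog by blast
    let ?R3 = "\<lambda>\<sigma>3. \<sigma>3 = \<sigma>2(13 := enc_bits (g n x))"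
    let ?R4 = "\<lambda>\<sigma>4. \<sigma>4 14 = Atom (hyp cap qs ks (g n x)) \<and>
       (\<forall>r. r \<notin> {14,15,16,17} \<longrightarrow> \<sigma>4 r = (\<sigma>2(13 := enc_bits (g n x))) r)"
    have frame: "\<sigma>2 r = \<sigma> r" if "r < 9 \<or> r = 19" for r
      using 2 R1 that by (auto simp: R1_def)
    show ?case
      unfolding sample_post_def
    proof (rule det_runs_seq[where R = ?R3], goal_cases)
      case 1
      show ?case
        using 2 \<rho> frame[of 0] assms(1) by (simp add: det_runs_def bind_return_pmf)
    next
      case (2 \<sigma>3)
      show ?case
      proof (rule det_runs_seq[where R = ?R4], goal_cases)
        case 1
        show ?case
          unfolding 2
          by (rule det_runs_eval_hyp) (use assms frame cap_pos in auto)
      next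
        case (2 \<sigma>4)
        have s4: "\<sigma>4 13 = enc_bits (g n x)" "\<sigma>4 14 = Atom (hyp cap qs ks (g n x))"
          "\<sigma>4 8 = Atom (int (length ks))" "\<sigma>4 22 = Atom b" "\<sigma>4 20 = Atom (a + 2 * E * sgnq q s)"
          "\<sigma>4 21 = Atom (e + 2 * E)" "\<sigma>4 10 = enc_list (map enc_bits S)"
          and f4: "\<And>r. r < 9 \<or> r = 19 \<Longrightarrow> \<sigma>4 r = \<sigma> r"
          using 2 s2 R1 assms frame by (auto simp: R1_def)
        show ?case
          using s4 f4 assms(6) q by (auto simp: det_runs_def bind_return_pmf Let_def sgnq_def)
      qed
    qed
  qed
  show ?thesis
    unfolding sample_step_def
    by (rule runs_mono[OF runs_det_seq[OF 1 2]]) (auto simp: step_bound_def)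
qed

lemma iterate_sample_step:
  assumes "\<sigma> 0 = Atom (int n)" "\<sigma> 2 = Atom E" "\<sigma> 7 = enc_list (map Atom ks)"
    "\<sigma> 8 = Atom (int (length ks))" "\<sigma> 19 = Atom cap" "length ks < length qs"
    "\<sigma> 10 = enc_list (map enc_bits S)"
    "\<sigma> 20 = Atom a" "\<sigma> 21 = Atom e" "\<sigma> 22 = Atom b" and q: "q = qs ! length ks"
  shows "rel_pmf (\<lambda>(\<sigma>', t) xs. (\<sigma>' 20 = Atom (a + sample_sum q S) \<and>
       \<sigma>' 21 = Atom (e + int (length S) * (2 * E)) \<and> \<sigma>' 22 = Atom (b + hyp_sum qs ks q xs) \<and>
       (\<forall>r. r < 9 \<or> r = 19 \<longrightarrow> \<sigma>' r = \<sigma> r)) \<and> t \<le> length S * (1 + step_bound \<kappa> (length ks)))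
     (iterate_com (length S) (exec \<kappa> qs (sample_step gprog)) \<sigma>)
     (replicate_pmf (length S) seeds)"
  using assms(1-10)
proof (induction S arbitrary: \<sigma> a e b)
  case Nil
  then show ?case by (simp add: sample_sum_def hyp_sum_def)
next
  case (Cons s S)
  show ?case
    unfolding list.size(4) add_Suc_right add_0_right iterate_com.simps replicate_pmf.simps
  proof (rule rel_pmf_bindI[OF runs_sample_step[where \<sigma> = \<sigma>, OF Cons.prems q, unfolded runs_def]], goal_cases)
    case (1 p x)
    obtain \<sigma>1 t1 where p: "p = (\<sigma>1, t1)" by (cases p)
    note R = 1[unfolded p, simplified]
    show ?case
      unfolding p prod.case
    proof (rule rel_pmf_bindI[OF Cons.IH[where \<sigma> = \<sigma>1 and a = "a + 2 * E * sgnq q s"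
            and e = "e + 2 * E" and b = "b + hyp cap qs ks (g n x) * sgnq q (g n x)"]], goal_cases)
      case (11 p' xs)
      then show ?case
        using R by (cases p') (auto simp: sample_sum_def hyp_sum_def algebra_simps)
    qed (use R Cons.prems in auto)
  qed
qed


definition shift :: "query list \<Rightarrow> int list \<Rightarrow> query \<Rightarrow> bool list list \<Rightarrow> bool list list \<Rightarrow> int" where
  "shift qs ks q S xs = quot0 (sample_sum q S - hyp_sum qs ks q xs) (int (length S))"

text \<open>The sample enters only through \<open>k\<close> and its size \<open>m\<close>. Once the
  coefficients are fixed, the transcript no longer depends on the sample, which is what the union
  bound exploits.\<close>

definition answer :: "query list \<Rightarrow> int list \<Rightarrow> query \<Rightarrow> nat \<Rightarrow> bool list list \<Rightarrow> int \<Rightarrow> real" where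
  "answer qs ks q m xs k =
     real_of_int (hyp_sum qs ks q xs + k * int m) / real_of_int (int m * (2 * E))"

lemma sample_sum_le: "\<bar>sample_sum q S\<bar> \<le> 2 * E * int (length S)"
  using abs_sum_list_le[of "sgnq q" 1 S] E_pos
  by (simp add: sample_sum_def abs_mult abs_sgnq)

lemma hyp_sum_le: "\<bar>hyp_sum qs ks q xs\<bar> \<le> cap * int (length xs)"
  unfolding hyp_sum_def
  by (rule abs_sum_list_le) (use hyp_bounds in \<open>simp add: abs_mult abs_sgnq\<close>)

text \<open>Guarantees that the \<open>shave\<close> loop completes the division.\<close>

lemma shift_arg_less:
  assumes "length xs = length S" "S \<noteq> []"
  shows "\<bar>sample_sum q S - hyp_sum qs ks q xs\<bar> < int (Suc (nat (2 * E + cap))) * int (length S)"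
proof -
  have "\<bar>sample_sum q S - hyp_sum qs ks q xs\<bar> \<le> (2 * E + cap) * int (length S)"
    using sample_sum_le[of q S] hyp_sum_le[of qs ks q xs] assms(1) by (simp add: distrib_right)
  also have "\<dots> < int (Suc (nat (2 * E + cap))) * int (length S)"
    using E_pos cap_pos assms(2) by (simp add: distrib_right)
  finally show ?thesis .
qed

text \<open>The invariant between rounds. Registers from 9 on are scratch space that each round
  overwrites before reading.\<close>

definition ready :: "store \<Rightarrow> bool list list \<Rightarrow> int list \<Rightarrow> bool" where
  "ready \<sigma> S ks \<longleftrightarrow> \<sigma> 0 = Atom (int n) \<and> \<sigma> 1 = Atom L \<and> \<sigma> 2 = Atom E \<and>
     \<sigma> 4 = Atom (int (length S)) \<and> \<sigma> 5 = enc_list (map enc_bits S) \<and>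
     \<sigma> 7 = enc_list (map Atom ks) \<and> \<sigma> 8 = Atom (int (length ks))"

definition round_bound :: "nat \<Rightarrow> nat \<Rightarrow> nat \<Rightarrow> nat" where
  "round_bound \<kappa> m t =
     100 + nat L * 10 + m * (1 + step_bound \<kappa> t) + nat (2 * E + cap) * 30"

lemma runs_round_prog:
  assumes rd: "ready \<sigma> S ks" and ne: "S \<noteq> []" and len: "length ks < length qs"
    and q: "q = qs ! length ks"
  shows "runs \<kappa> qs (round_prog gprog) \<sigma> (replicate_pmf (length S) seeds)
    (\<lambda>\<sigma>' xs. ready \<sigma>' S (shift qs ks q S xs # ks) \<and>
       answer_of \<sigma>' = answer qs ks q (length S) xs (shift qs ks q S xs) \<and> length xs = length S)
    (round_bound \<kappa> (length S) (length ks))"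
proof -
  define R1 where "R1 = (\<lambda>\<sigma>'. \<sigma>' 10 = enc_list (map enc_bits S) \<and> \<sigma>' 19 = Atom cap \<and>
    \<sigma>' 20 = Atom 0 \<and> \<sigma>' 21 = Atom 0 \<and> \<sigma>' 22 = Atom 0 \<and> (\<forall>r<9. \<sigma>' r = \<sigma> r))"
  define R2 where "R2 = (\<lambda>\<sigma>' xs. (\<sigma>' 20 = Atom (sample_sum q S) \<and>
       \<sigma>' 21 = Atom (int (length S) * (2 * E)) \<and> \<sigma>' 22 = Atom (hyp_sum qs ks q xs) \<and>
       \<sigma>' 19 = Atom cap \<and> (\<forall>r<9. \<sigma>' r = \<sigma> r)))"
  have pre: "det_runs \<kappa> qs (Seq (Assign 19 (Const 0)) (Seq (Loop (Var 1) add_cap)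
    (Seq (Assign 20 (Const 0)) (Seq (Assign 21 (Const 0)) (Seq (Assign 22 (Const 0))
         (Assign 10 (Var 5))))))) \<sigma> R1 (40 + nat L * 10)"
  proof -
    obtain t where "iterate_com (nat L) (exec \<kappa> qs add_cap) (\<sigma>(19 := Atom 0)) =
        return_pmf (\<sigma>(19 := Atom 0, 19 := Atom (0 + int (nat L) * (2 * E))), t)" "t \<le> nat L * 10"
      using iterate_add_cap[of "\<sigma>(19 := Atom 0)" 0 E "nat L" \<kappa> qs] rd
      unfolding ready_def by auto
    then show ?thesis
      using rd L_pos unfolding det_runs_def R1_def ready_def
      by (auto simp: bind_return_pmf cap_def)
  qed
  have loop: "runs \<kappa> qs (Loop (Var 4) (sample_step gprog)) \<sigma>1 (replicate_pmf (length S) seeds) R2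
      (2 + length S * (1 + step_bound \<kappa> (length ks)))" if "R1 \<sigma>1" for \<sigma>1
  proof -
    have "rel_pmf (\<lambda>(\<sigma>', t) xs. (\<sigma>' 20 = Atom (0 + sample_sum q S) \<and>
       \<sigma>' 21 = Atom (0 + int (length S) * (2 * E)) \<and> \<sigma>' 22 = Atom (0 + hyp_sum qs ks q xs) \<and>
       (\<forall>r. r < 9 \<or> r = 19 \<longrightarrow> \<sigma>' r = \<sigma>1 r)) \<and> t \<le> length S * (1 + step_bound \<kappa> (length ks)))
     (iterate_com (length S) (exec \<kappa> qs (sample_step gprog)) \<sigma>1)
     (replicate_pmf (length S) seeds)"
      by (rule iterate_sample_step) (use that rd len q in \<open>auto simp: R1_def ready_def\<close>)
    then have "rel_pmf (\<lambda>(\<sigma>', t) xs. R2 \<sigma>' xs \<and> t \<le> 2 + length S * (1 + step_bound \<kappa> (length ks)))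
     (iterate_com (length S) (exec \<kappa> qs (sample_step gprog)) \<sigma>1 \<bind>
        (\<lambda>(\<sigma>', t). return_pmf (\<sigma>', 2 + t)))
     (replicate_pmf (length S) seeds \<bind> return_pmf)"
      by (rule rel_pmf_bindI) (use that in \<open>auto simp: R1_def R2_def\<close>)
    moreover have "\<sigma>1 4 = Atom (int (length S))"
      using that rd by (auto simp: R1_def ready_def)
    ultimately show ?thesis
      by (simp add: runs_def bind_return_pmf' numeral_2_eq_2)
  qed
  have post: "det_runs \<kappa> qs (Seq (Assign 9 (Minus (Var 20) (Var 22)))
    (Seq (Assign 18 (Const 0))
    (Seq (Loop (Plus (Plus (Var 2) (Var 2)) (Var 19)) shave)
    (Seq (Assign 6 (Cons_of (Minus (Var 20) (Var 9)) (Var 21)))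
    (Seq (Assign 7 (Cons_of (Var 18) (Var 7)))
         (Assign 8 (Plus (Var 8) (Const 1)))))))) \<sigma>2
    (\<lambda>\<sigma>'. ready \<sigma>' S (shift qs ks q S xs # ks) \<and>
       answer_of \<sigma>' = answer qs ks q (length S) xs (shift qs ks q S xs) \<and> length xs = length S)
    (50 + nat (2 * E + cap) * 30)"
    if R2: "R2 \<sigma>2 xs" and xs: "length xs = length S" for \<sigma>2 xs
  proof -
    let ?d = "sample_sum q S - hyp_sum qs ks q xs" and ?m = "int (length S)"
    let ?N = "nat (2 * E + cap)"
    let ?\<sigma> = "\<sigma>2(9 := Atom ?d, 18 := Atom 0)"
    have "\<exists>\<sigma>' t. iterate_com ?N (exec \<kappa> qs shave) ?\<sigma> = return_pmf (\<sigma>', t) \<and>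
        \<sigma>' 9 = Atom (?d - quot0 ?d ?m * ?m) \<and> \<sigma>' 18 = Atom (0 + quot0 ?d ?m) \<and>
        (\<forall>r. r \<notin> {9,18} \<longrightarrow> \<sigma>' r = ?\<sigma> r) \<and> t \<le> ?N * 30"
      by (rule iterate_shave) (use R2 rd ne shift_arg_less[OF xs ne] in \<open>auto simp: R2_def ready_def\<close>)
    then obtain \<sigma>' t where *: "iterate_com ?N (exec \<kappa> qs shave) ?\<sigma> = return_pmf (\<sigma>', t)"
        "\<sigma>' 9 = Atom (?d - quot0 ?d ?m * ?m)" "\<sigma>' 18 = Atom (quot0 ?d ?m)"
        "\<And>r. r \<noteq> 9 \<Longrightarrow> r \<noteq> 18 \<Longrightarrow> \<sigma>' r = \<sigma>2 r" "t \<le> ?N * 30" by auto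
    \<comment> \<open>Sample sum minus remainder is the numerator in \<open>answer\<close>.\<close>
    have "sample_sum q S - (?d - quot0 ?d ?m * ?m) = hyp_sum qs ks q xs + quot0 ?d ?m * ?m"
      by simp
    then show ?thesis
      using * R2 rd xs unfolding det_runs_def ready_def R2_def
      by (simp add: bind_return_pmf answer_of_def answer_def shift_def)
  qed
  have "runs \<kappa> qs (round_prog gprog) \<sigma> (replicate_pmf (length S) seeds)
    (\<lambda>\<sigma>' xs. ready \<sigma>' S (shift qs ks q S xs # ks) \<and>
       answer_of \<sigma>' = answer qs ks q (length S) xs (shift qs ks q S xs) \<and> length xs = length S)
    ((40 + nat L * 10) + ((2 + length S * (1 + step_bound \<kappa> (length ks))) +
       (50 + nat (2 * E + cap) * 30)))"
    unfolding round_prog_def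
    by (rule runs_det_seq[OF pre], rule runs_seq_det[OF runs_support[OF loop]], assumption)
       (rule post, auto simp: set_replicate_pmf)
  then show ?thesis
    by (rule runs_mono) (auto simp: round_bound_def)
qed

end

subsection \<open>Concentration\<close>

text \<open>Independence factorises the moment generating function, and Hoeffding's lemma bounds
  each factor.\<close>

lemma nn_integral_exp_replicate_pmf_le:
  fixes f :: "'a \<Rightarrow> real"
  assumes f: "\<And>x. x \<in> set_pmf p \<Longrightarrow> f x \<in> {a..b}" and l: "0 < l"
  shows "(\<integral>\<^sup>+xs. exp (l * (\<Sum>x\<leftarrow>xs. f x - measure_pmf.expectation p f)) \<partial>replicate_pmf n p) \<le>
    ennreal (exp (real n * (l\<^sup>2 * (b - a)\<^sup>2 / 8)))"
proof (induction n)
  case (Suc n)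
  let ?\<mu> = "measure_pmf.expectation p f"
  interpret interval_bounded_random_variable p f a b
    by unfold_locales (use f in \<open>auto simp: AE_measure_pmf_iff\<close>)
  have "(\<integral>\<^sup>+xs. exp (l * (\<Sum>x\<leftarrow>xs. f x - ?\<mu>)) \<partial>replicate_pmf (Suc n) p) =
     (\<integral>\<^sup>+x. \<integral>\<^sup>+xs. ennreal (exp (l * (f x - ?\<mu>))) * exp (l * (\<Sum>x\<leftarrow>xs. f x - ?\<mu>))
        \<partial>replicate_pmf n p \<partial>p)"
    by (simp add: distrib_left exp_add ennreal_mult)
  also have "\<dots> = (\<integral>\<^sup>+x. exp (l * (f x - ?\<mu>)) \<partial>p) *
      (\<integral>\<^sup>+xs. exp (l * (\<Sum>x\<leftarrow>xs. f x - ?\<mu>)) \<partial>replicate_pmf n p)"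
    by (simp add: nn_integral_cmult nn_integral_multc)
  also have "\<dots> \<le> ennreal (exp (l\<^sup>2 * (b - a)\<^sup>2 / 8)) *
      ennreal (exp (real n * (l\<^sup>2 * (b - a)\<^sup>2 / 8)))"
    using Hoeffdings_lemma_nn_integral[OF l] by (intro mult_mono Suc.IH) auto
  also have "\<dots> = ennreal (exp (real (Suc n) * (l\<^sup>2 * (b - a)\<^sup>2 / 8)))"
    by (simp add: ennreal_mult[symmetric] exp_add[symmetric] distrib_right)
  finally show ?case .
qed simp

lemma replicate_pmf_upper_tail:
  fixes f :: "'a \<Rightarrow> real"
  assumes f: "\<And>x. x \<in> set_pmf p \<Longrightarrow> f x \<in> {a..b}" and t: "0 < t" and ab: "a < b"
  shows "emeasure (replicate_pmf n p)
      {xs. real n * t \<le> (\<Sum>x\<leftarrow>xs. f x - measure_pmf.expectation p f)} \<le>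
    ennreal (exp (- (2 * real n * t\<^sup>2 / (b - a)\<^sup>2)))"
proof -
  let ?\<mu> = "measure_pmf.expectation p f"
  \<comment> \<open>This value minimises the Chernoff exponent
    \<open>- l * t + l\<^sup>2 * (b - a)\<^sup>2 / 8\<close>.\<close>
  define l where "l = 4 * t / (b - a)\<^sup>2"
  have l: "0 < l" using t ab by (simp add: l_def)
  let ?u = "\<lambda>xs. ennreal (exp (l * (\<Sum>x\<leftarrow>xs. f x - ?\<mu>)))"
  let ?c = "ennreal (exp (- (l * (real n * t))))"
  have "{xs. real n * t \<le> (\<Sum>x\<leftarrow>xs. f x - ?\<mu>)} \<subseteq> {xs \<in> UNIV. 1 \<le> ?c * ?u xs}"
    using l by (auto simp: ennreal_mult[symmetric] exp_add[symmetric] simp del: ennreal_1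
        simp flip: ennreal_1)
  then have "emeasure (replicate_pmf n p) {xs. real n * t \<le> (\<Sum>x\<leftarrow>xs. f x - ?\<mu>)} \<le>
      emeasure (replicate_pmf n p) {xs \<in> UNIV. 1 \<le> ?c * ?u xs}"
    by (intro emeasure_mono) auto
  also have "\<dots> \<le> ?c * (\<integral>\<^sup>+xs. ?u xs * indicator UNIV xs \<partial>replicate_pmf n p)"
    by (rule nn_integral_Markov_inequality) auto
  also have "\<dots> \<le> ?c * ennreal (exp (real n * (l\<^sup>2 * (b - a)\<^sup>2 / 8)))"
    using nn_integral_exp_replicate_pmf_le[OF f l, where n = n] by (intro mult_left_mono) auto
  also have "\<dots> = ennreal (exp (- (l * (real n * t)) + real n * (l\<^sup>2 * (b - a)\<^sup>2 / 8)))"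
    by (simp add: ennreal_mult[symmetric] exp_add[symmetric])
  also have "- (l * (real n * t)) + real n * (l\<^sup>2 * (b - a)\<^sup>2 / 8) = - (2 * real n * t\<^sup>2 / (b - a)\<^sup>2)"
  proof -
    have "- (4 * t / w\<^sup>2 * (real n * t)) + real n * ((4 * t / w\<^sup>2)\<^sup>2 * w\<^sup>2 / 8) =
        - (2 * real n * t\<^sup>2 / w\<^sup>2)" if "w \<noteq> 0" for w
      using that by (simp add: field_simps power2_eq_square)
    from this[of "b - a"] show ?thesis using ab by (simp add: l_def)
  qed
  finally show ?thesis .
qed

lemma replicate_pmf_tail:
  fixes f :: "'a \<Rightarrow> real"
  assumes f: "\<And>x. x \<in> set_pmf p \<Longrightarrow> f x \<in> {a..b}" and t: "0 < t" and ab: "a < b"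
  shows "emeasure (replicate_pmf n p)
      {xs. real n * t \<le> \<bar>\<Sum>x\<leftarrow>xs. f x - measure_pmf.expectation p f\<bar>} \<le>
    ennreal (2 * exp (- (2 * real n * t\<^sup>2 / (b - a)\<^sup>2)))"
proof -
  let ?\<mu> = "measure_pmf.expectation p f" and ?e = "exp (- (2 * real n * t\<^sup>2 / (b - a)\<^sup>2))"
  let ?U = "{xs. real n * t \<le> (\<Sum>x\<leftarrow>xs. f x - ?\<mu>)}"
  let ?L = "{xs. real n * t \<le> (\<Sum>x\<leftarrow>xs. - f x - measure_pmf.expectation p (\<lambda>x. - f x))}"
  have neg: "(\<Sum>x\<leftarrow>xs. - f x - measure_pmf.expectation p (\<lambda>x. - f x)) = - (\<Sum>x\<leftarrow>xs. f x - ?\<mu>)" for xs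
    by (induction xs) auto
  have "emeasure (replicate_pmf n p) {xs. real n * t \<le> \<bar>\<Sum>x\<leftarrow>xs. f x - ?\<mu>\<bar>} \<le>
      emeasure (replicate_pmf n p) (?U \<union> ?L)"
    unfolding neg by (rule emeasure_mono) (auto simp: abs_real_def split: if_splits)
  also have "\<dots> \<le> emeasure (replicate_pmf n p) ?U + emeasure (replicate_pmf n p) ?L"
    by (rule emeasure_subadditive) auto
  also have "\<dots> \<le> ennreal ?e + ennreal ?e"
  proof (rule add_mono)
    show "emeasure (replicate_pmf n p) ?L \<le> ennreal ?e"
      using replicate_pmf_upper_tail[where f = "\<lambda>x. - f x" and a = "- b" and b = "- a", OF _ t, where p = p and n = n]
        f ab by simp
  qed (rule replicate_pmf_upper_tail[OF f t ab])
  also have "\<dots> = ennreal (2 * ?e)" by (simp flip: ennreal_plus)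
  finally show ?thesis .
qed

text \<open>A two-sided geometric series: the price of one round in the union bound over
  coefficients.\<close>

lemma sum_powr_abs_le:
  fixes x :: real
  assumes "1 < x"
  shows "(\<Sum>k\<in>{- int K..int K}. x powr (- real_of_int \<bar>k\<bar>)) \<le> (x + 1) / (x - 1)"
proof -
  \<comment> \<open>The exact partial sum, limit minus tail, is what the induction needs.\<close>
  have "(\<Sum>k\<in>{- int K..int K}. x powr (- real_of_int \<bar>k\<bar>)) =
      (x + 1) / (x - 1) - 2 * x powr (- real K) / (x - 1)"
  proof (induction K)
    case 0
    then show ?case using assms by (simp add: diff_divide_distrib[symmetric])
  next
    case (Suc K)
    have *: "{- int (Suc K)..int (Suc K)} = insert (- int (Suc K)) (insert (int (Suc K)) {- int K..int K})"
      by auto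
    define y where "y = x powr (- real (Suc K))"
    have y: "x powr (- 1 - real K) = y" "x powr (- real K - 1) = y"
      unfolding y_def by (rule arg_cong2[where f = "(powr)"]; simp)+
    have xK: "x powr - real K = x * y"
      using assms by (simp add: y_def powr_diff powr_minus field_simps)
    have "2 * y = 2 * (x * y) / (x - 1) - 2 * y / (x - 1)"
    proof -
      have "2 * (x * y) / (x - 1) - 2 * y / (x - 1) = 2 * y * (x - 1) / (x - 1)"
        unfolding diff_divide_distrib[symmetric] by (simp add: algebra_simps)
      then show ?thesis using assms by simp
    qed
    moreover have "(\<Sum>k\<in>{- int (Suc K)..int (Suc K)}. x powr (- real_of_int \<bar>k\<bar>)) =
        y + (y + (\<Sum>k\<in>{- int K..int K}. x powr (- real_of_int \<bar>k\<bar>)))"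
      unfolding * by (simp add: y)
    ultimately show ?case
      using Suc unfolding xK y_def[symmetric] by linarith
  qed
  then show ?thesis using assms by simp
qed


subsection \<open>The potential\<close>

text \<open>
  \<open>clip_energy\<close> is a convex primitive of the clipping function: it is the maximum of \<open>a * u - a\<^sup>2 / 2\<close> over
  \<open>a\<close> in \<open>[0, c]\<close>.
\<close>

definition clip :: "real \<Rightarrow> real \<Rightarrow> real" where
  "clip c u = max 0 (min c u)"

definition clip_energy :: "real \<Rightarrow> real \<Rightarrow> real" where
  "clip_energy c u = clip c u * u - (clip c u)\<^sup>2 / 2"

text \<open>The variational inequality of the projection of \<open>u\<close> onto the interval from
  0 to \<open>c\<close>.\<close>

lemma clip_projection:
  assumes "0 \<le> r" "r \<le> c"
  shows "0 \<le> (clip c u - r) * (u - clip c u)"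
  using assms by (auto simp: clip_def max_def min_def mult_nonpos_nonpos mult_nonneg_nonpos)

lemma clip_bounds: "0 \<le> c \<Longrightarrow> 0 \<le> clip c u" "0 \<le> c \<Longrightarrow> clip c u \<le> c"
  by (auto simp: clip_def)

text \<open>The maximum that \<open>clip_energy\<close> represents is at least the value at
  \<open>a = r\<close>, and \<open>r\<^sup>2 \<le> c\<^sup>2\<close>.\<close>

lemma clip_energy_ge:
  assumes "0 \<le> r" "r \<le> c"
  shows "- c\<^sup>2 / 2 \<le> clip_energy c u - r * u"
proof -
  have "clip_energy c u - r * u + r\<^sup>2 / 2 = (clip c u - r) * (u - clip c u) + (clip c u - r)\<^sup>2 / 2"
    by (simp add: clip_energy_def field_simps power2_eq_square)
  moreover have "r\<^sup>2 \<le> c\<^sup>2" using assms by (intro power_mono) auto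
  ultimately show ?thesis
    using clip_projection[OF assms, of u] zero_le_power2[of "clip c u - r"] by linarith
qed

text \<open>The derivative \<open>clip c\<close> is 1-Lipschitz, so the second-order error is at
  most \<open>v\<^sup>2 / 2\<close>. Exactly, the slack is a projection term plus half a
  square.\<close>

lemma clip_energy_add_le:
  assumes "0 \<le> c"
  shows "clip_energy c (u + v) \<le> clip_energy c u + clip c u * v + v\<^sup>2 / 2"
proof -
  let ?a = "clip c u" and ?b = "clip c (u + v)"
  have "clip_energy c u + ?a * v + v\<^sup>2 / 2 - clip_energy c (u + v) =
      (?a - ?b) * (u - ?a) + (?b - ?a - v)\<^sup>2 / 2"
    by (simp add: clip_energy_def field_simps power2_eq_square)
  then show ?thesis
    using clip_projection[of ?b c u] clip_bounds[OF assms] zero_le_power2[of "?b - ?a - v"]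
    by (smt (verit) divide_nonneg_nonneg)
qed

text \<open>Rounding towards 0 preserves the sign and does not increase the absolute value. The
  first bound serves accuracy, the second pays for the quadratic term of the potential, and the
  third limits the range of coefficients.\<close>

lemma quot0_props:
  assumes "0 < m"
  shows "\<bar>d - quot0 d m * m\<bar> < m" "(quot0 d m)\<^sup>2 * m \<le> quot0 d m * d" "\<bar>quot0 d m\<bar> * m \<le> \<bar>d\<bar>"
proof -
  have a: "\<bar>d\<bar> div m * m \<le> \<bar>d\<bar>" "\<bar>d\<bar> - \<bar>d\<bar> div m * m < m"
    using assms div_mult_mod_eq[of "\<bar>d\<bar>" m] pos_mod_sign[of m "\<bar>d\<bar>"] pos_mod_bound[of m "\<bar>d\<bar>"]
    by linarith+
  have c: "0 \<le> \<bar>d\<bar> div m" using assms by (simp add: pos_imp_zdiv_nonneg_iff)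
  have b: "(\<bar>d\<bar> div m) * (\<bar>d\<bar> div m * m) \<le> (\<bar>d\<bar> div m) * \<bar>d\<bar>"
    using a c by (intro mult_left_mono)
  consider "d = 0" | "0 < d" | "d < 0" by linarith
  then have "\<bar>d - quot0 d m * m\<bar> < m \<and> (quot0 d m)\<^sup>2 * m \<le> quot0 d m * d \<and> \<bar>quot0 d m\<bar> * m \<le> \<bar>d\<bar>"
    using a b c assms by cases (auto simp: quot0_def power2_eq_square mult.assoc)
  then show "\<bar>d - quot0 d m * m\<bar> < m" "(quot0 d m)\<^sup>2 * m \<le> quot0 d m * d" "\<bar>quot0 d m\<bar> * m \<le> \<bar>d\<bar>"
    by auto
qed

lemma sum_list_diff_const:
  "(\<Sum>x\<leftarrow>xs. f x - c) = (\<Sum>x\<leftarrow>xs. f x) - real (length xs) * (c :: real)"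
  by (induction xs) (auto simp: algebra_simps)

lemma of_int_sum_list: "real_of_int (\<Sum>x\<leftarrow>xs. f x) = (\<Sum>x\<leftarrow>xs. real_of_int (f x))"
  by (induction xs) auto

section \<open>Descent of the potential for a dense target\<close>

locale dense_target = generator +
  fixes I :: "bool list set" and D :: "bool list pmf"
  assumes fin_I: "finite I" and g_in_I: "\<And>x. x \<in> bitstrings n \<Longrightarrow> g n x \<in> I"
    and D_I: "set_pmf D \<subseteq> I"
    and dense: "\<And>i. i \<in> I \<Longrightarrow> pmf D i \<le> real_of_int L * pmf (generated_dist n (g n)) i"
begin

abbreviation Dg :: "bool list pmf" where
  "Dg \<equiv> generated_dist n (g n)"

lemma set_seeds: "set_pmf seeds = bitstrings n"
  using finite_lists_length_eq[of "UNIV :: bool set" n]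
  by (subst set_pmf_of_set) (auto simp: bitstrings_def intro: exI[of _ "replicate n True"])

lemma set_Dg: "set_pmf Dg \<subseteq> I"
  using g_in_I set_seeds by (auto simp: generated_dist_def)

lemma finite_D: "finite (set_pmf D)" and finite_Dg: "finite (set_pmf Dg)"
  using D_I set_Dg fin_I finite_subset by auto

lemma integrable_D [simp]: "integrable (measure_pmf D) (f :: _ \<Rightarrow> real)"
  and integrable_Dg [simp]: "integrable (measure_pmf Dg) (f :: _ \<Rightarrow> real)"
  using finite_D finite_Dg by (auto intro: integrable_measure_pmf_finite)

lemma expectation_I:
  fixes f :: "bool list \<Rightarrow> real"
  assumes "set_pmf p \<subseteq> I"
  shows "measure_pmf.expectation p f = (\<Sum>i\<in>I. pmf p i * f i)"
  using assms fin_I by (subst integral_measure_pmf[of I]) auto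

lemmas expectation_D = expectation_I[OF D_I] and expectation_Dg = expectation_I[OF set_Dg]

definition target :: "query \<Rightarrow> real" where
  "target q = measure_pmf.expectation D (\<lambda>i. real_of_int (sgnq q i))"

definition hyp_mean :: "query list \<Rightarrow> int list \<Rightarrow> query \<Rightarrow> real" where
  "hyp_mean qs ks q = measure_pmf.expectation Dg (\<lambda>i. real_of_int (hyp cap qs ks i * sgnq q i))"

text \<open>Its derivative with respect to the score, relative to \<open>Dg\<close>, is the clipped
  score minus \<open>2 * E\<close> times the density of \<open>D\<close>. A query that tells the
  hypothesis from \<open>D\<close> is thus a direction of descent.\<close>

definition potential :: "query list \<Rightarrow> int list \<Rightarrow> real" where
  "potential qs ks =
     measure_pmf.expectation Dg (\<lambda>i. clip_energy cap (score qs ks i)) -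
     2 * E * measure_pmf.expectation D (\<lambda>i. real_of_int (score qs ks i))"

text \<open>The tolerance is an eighth of a unit \<open>1 / (2 * E)\<close>, as in
  \<open>badB\<close>. Together they cost at most \<open>\<bar>k\<bar> / 4\<close> of potential,
  half of the guaranteed gain \<open>\<bar>k\<bar> / 2\<close>.\<close>

definition badA :: "bool list list \<Rightarrow> query \<Rightarrow> bool" where
  "badA S q \<longleftrightarrow> length S / 8 < \<bar>real_of_int (sample_sum q S) - length S * (2 * E * target q)\<bar>"

definition badB :: "query list \<Rightarrow> int list \<Rightarrow> query \<Rightarrow> bool list list \<Rightarrow> bool" where
  "badB qs ks q xs \<longleftrightarrow>
     length xs / 8 < \<bar>real_of_int (hyp_sum qs ks q xs) - length xs * hyp_mean qs ks q\<bar>"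

lemma hyp_eq_clip: "real_of_int (hyp cap qs ks i) = clip cap (score qs ks i)"
  by (simp add: hyp_def clip_def of_int_max of_int_min)

text \<open>Pointwise this is \<open>clip_energy_ge\<close> with \<open>r\<close> equal to
  \<open>2 * E\<close> times the density of \<open>D\<close> at \<open>i\<close>; density at most
  \<open>L\<close> means \<open>r \<le> cap\<close>. Points of \<open>Dg\<close>-mass 0 have
  \<open>D\<close>-mass 0 and contribute nothing.\<close>

lemma potential_ge: "- (real_of_int cap)\<^sup>2 / 2 \<le> potential qs ks"
proof -
  let ?u = "\<lambda>i. real_of_int (score qs ks i)"
  have "(\<Sum>i\<in>I. pmf Dg i * (- (real_of_int cap)\<^sup>2 / 2)) \<le>
      (\<Sum>i\<in>I. pmf Dg i * clip_energy cap (?u i) - 2 * E * (pmf D i * ?u i))"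
  proof (rule sum_mono)
    fix i assume i: "i \<in> I"
    show "pmf Dg i * (- (real_of_int cap)\<^sup>2 / 2) \<le>
        pmf Dg i * clip_energy cap (?u i) - 2 * E * (pmf D i * ?u i)"
    proof (cases "pmf Dg i = 0")
      case True
      then have "pmf D i = 0" using dense[OF i] pmf_nonneg[of D i] by simp
      with True show ?thesis by simp
    next
      case False
      then have p: "0 < pmf Dg i" using pmf_nonneg[of Dg i] by simp
      let ?r = "2 * E * pmf D i / pmf Dg i"
      have "E * pmf D i \<le> E * (real_of_int L * pmf Dg i)"
        using dense[OF i] E_pos by (intro mult_left_mono) auto
      then have "?r \<le> cap"
        using p by (simp add: cap_def field_simps)
      moreover have "0 \<le> ?r" using E_pos by simp
      ultimately have "- (real_of_int cap)\<^sup>2 / 2 \<le> clip_energy cap (?u i) - ?r * ?u i"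
        by (intro clip_energy_ge)
      then have "pmf Dg i * (- (real_of_int cap)\<^sup>2 / 2) \<le>
          pmf Dg i * (clip_energy cap (?u i) - ?r * ?u i)"
        using p by (intro mult_left_mono) auto
      also have "\<dots> = pmf Dg i * clip_energy cap (?u i) - 2 * E * (pmf D i * ?u i)"
        using p by (simp add: right_diff_distrib)
      finally show ?thesis .
    qed
  qed
  moreover have "(\<Sum>i\<in>I. pmf Dg i * (- (real_of_int cap)\<^sup>2 / 2)) = - (real_of_int cap)\<^sup>2 / 2"
    unfolding sum_distrib_right[symmetric] using sum_pmf_eq_1[OF fin_I set_Dg] by simp
  ultimately show ?thesis
    unfolding potential_def expectation_D expectation_Dg sum_distrib_left sum_subtractf by simp
qed

lemma potential_Nil: "potential [] [] = 0"
  using cap_pos by (simp add: potential_def clip_energy_def clip_def)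

text \<open>The increment of the score is \<open>v = k * sgnq q i\<close>, and
  \<open>v\<^sup>2 = k\<^sup>2\<close> at every point.\<close>

lemma potential_Cons_le:
  assumes "length ks = length qs"
  shows "potential (qs @ [q]) (k # ks) \<le>
    potential qs ks - k * (2 * E * target q - hyp_mean qs ks q) + k\<^sup>2 / 2"
proof -
  let ?u = "\<lambda>i. real_of_int (score qs ks i)" and ?s = "\<lambda>i. real_of_int (sgnq q i)"
  have sc: "score (qs @ [q]) (k # ks) i = score qs ks i + k * sgnq q i" for i
    using assms by (simp add: score_append)
  have "clip_energy cap (score (qs @ [q]) (k # ks) i) \<le>
      clip_energy cap (?u i) + k * (hyp cap qs ks i * sgnq q i) + k\<^sup>2 / 2" for i
  proof -
    have "(sgnq q i)\<^sup>2 = 1" by (simp add: sgnq_def)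
    then have "(real_of_int (k * sgnq q i))\<^sup>2 = k\<^sup>2"
      by (metis mult.right_neutral of_int_power power_mult_distrib)
    moreover have "real_of_int k * (real_of_int (hyp cap qs ks i) * ?s i) = clip cap (?u i) * (k * ?s i)"
      by (simp add: hyp_eq_clip)
    ultimately show ?thesis
      using clip_energy_add_le[of cap "?u i" "real_of_int (k * sgnq q i)"] cap_pos
      unfolding sc of_int_add of_int_mult by linarith
  qed
  then have "measure_pmf.expectation Dg (\<lambda>i. clip_energy cap (score (qs @ [q]) (k # ks) i)) \<le>
      measure_pmf.expectation Dg (\<lambda>i. clip_energy cap (?u i) +
          k * real_of_int (hyp cap qs ks i * sgnq q i) + k\<^sup>2 / 2)"
    by (intro integral_mono) auto
  also have "\<dots> = measure_pmf.expectation Dg (\<lambda>i. clip_energy cap (?u i)) + k * hyp_mean qs ks q + k\<^sup>2 / 2"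
    unfolding hyp_mean_def by (subst Bochner_Integration.integral_add | simp)+
  finally have 1: "measure_pmf.expectation Dg (\<lambda>i. clip_energy cap (score (qs @ [q]) (k # ks) i)) \<le> \<dots>" .
  have 2: "measure_pmf.expectation D (\<lambda>i. real_of_int (score (qs @ [q]) (k # ks) i)) =
      measure_pmf.expectation D ?u + k * target q"
    unfolding target_def sc by (simp add: integral_add)
  show ?thesis
    using 1 unfolding potential_def 2 by (simp add: algebra_simps)
qed

text \<open>With exact means, \<open>k\<^sup>2 \<le> k * ?t\<close> gives a drop of
  \<open>k\<^sup>2 / 2\<close>. The errors cost \<open>\<bar>k\<bar> / 4\<close>.\<close>

lemma potential_shift_le:
  assumes ks: "length ks = length qs" and S: "S \<noteq> []" "length xs = length S"
    and good: "\<not> badA S q" "\<not> badB qs ks q xs"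
  defines "k \<equiv> shift qs ks q S xs"
  shows "potential (qs @ [q]) (k # ks) \<le> potential qs ks - \<bar>k\<bar> / 4"
proof -
  let ?m = "real (length S)" and ?d = "sample_sum q S - hyp_sum qs ks q xs"
  let ?t = "2 * E * target q - hyp_mean qs ks q"
  have m: "0 < ?m" using S by simp
  have "k\<^sup>2 * int (length S) \<le> k * ?d"
    unfolding k_def shift_def by (rule quot0_props) (use S in simp)
  then have "real_of_int (k\<^sup>2 * int (length S)) \<le> real_of_int (k * ?d)"
    by (simp only: of_int_le_iff)
  then have kd: "real_of_int k ^ 2 * ?m \<le> k * real_of_int ?d" by simp
  have "\<bar>real_of_int ?d - ?m * ?t\<bar> \<le> ?m / 4"
    using good S(2) unfolding badA_def badB_def by (simp add: algebra_simps abs_real_def split: if_splits)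
  then have "\<bar>k\<bar> * \<bar>real_of_int ?d - ?m * ?t\<bar> \<le> \<bar>k\<bar> * (?m / 4)"
    by (intro mult_left_mono) auto
  moreover have "k * (real_of_int ?d - ?m * ?t) \<le> \<bar>k\<bar> * \<bar>real_of_int ?d - ?m * ?t\<bar>"
    by (metis abs_ge_self abs_mult of_int_abs)
  moreover have "k * (real_of_int ?d - ?m * ?t) = k * real_of_int ?d - ?m * (k * ?t)"
    by (simp only: right_diff_distrib mult.left_commute)
  ultimately have "k * real_of_int ?d - ?m * (k * ?t) \<le> \<bar>k\<bar> * (?m / 4)"
    by linarith
  then have "real_of_int k ^ 2 * ?m - \<bar>k\<bar> * (?m / 4) \<le> ?m * (k * ?t)"
    using kd by linarith
  then have "?m * (real_of_int k ^ 2 - \<bar>k\<bar> / 4) \<le> ?m * (k * ?t)"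
    by (simp add: algebra_simps)
  then have kt: "real_of_int k ^ 2 - \<bar>k\<bar> / 4 \<le> k * ?t"
    using m by (simp only: mult_le_cancel_left_pos)
  \<comment> \<open>Integrality of \<open>k\<close> is used here: the quadratic gain dominates the
    linear error.\<close>
  have "\<bar>k\<bar> \<le> k\<^sup>2"
    using self_le_power[of "\<bar>k\<bar>" 2] by (cases "k = 0") auto
  then have "real_of_int \<bar>k\<bar> \<le> real_of_int k ^ 2"
    by (metis of_int_le_iff of_int_power)
  then show ?thesis
    using potential_Cons_le[OF ks, of q k] kt by simp
qed

text \<open>The estimate from the hypothesis cancels: the answer is the sample mean up to a
  remainder below one unit \<open>1 / (2 * E)\<close>, and the sample mean is off by an eighth of a
  unit. Two units make \<open>1 / E\<close>.\<close>

lemma answer_accurate: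
  assumes S: "S \<noteq> []" and good: "\<not> badA S q"
  shows "\<bar>answer qs ks q (length S) xs (shift qs ks q S xs) - target q\<bar> \<le> 1 / E"
proof -
  let ?m = "real (length S)" and ?h = "hyp_sum qs ks q xs" and ?k = "shift qs ks q S xs"
  have m: "0 < ?m" using S by simp
  have E: "0 < real_of_int E" using E_pos by simp
  have "\<bar>(sample_sum q S - ?h) - ?k * int (length S)\<bar> < int (length S)"
    unfolding shift_def by (rule quot0_props) (use S in simp)
  then have "\<bar>real_of_int (?h + ?k * int (length S)) - sample_sum q S\<bar> < ?m"
    by linarith
  then have "\<bar>real_of_int (?h + ?k * int (length S)) - ?m * (2 * E * target q)\<bar> \<le> 2 * ?m"
    using good unfolding badA_def by linarith
  moreover have "answer qs ks q (length S) xs ?k - target q =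
      (real_of_int (?h + ?k * int (length S)) - ?m * (2 * E * target q)) / (?m * (2 * E))"
    using m E by (simp add: answer_def field_simps)
  ultimately have "\<bar>answer qs ks q (length S) xs ?k - target q\<bar> \<le> 2 * ?m / (?m * (2 * E))"
    using m E by (simp only: abs_divide abs_of_pos mult_pos_pos zero_less_numeral of_int_mult
        of_int_numeral) (rule divide_right_mono, auto)
  also have "\<dots> = 1 / E" using m by simp
  finally show ?thesis .
qed

end

subsection \<open>Adaptive rounds\<close>

context generator
begin

lemma hyp_sum_snoc:
  "length ks \<le> length qs \<Longrightarrow> hyp_sum (qs @ [q]) ks q xs = hyp_sum qs ks q xs"
  by (simp add: hyp_sum_def hyp_def score_append)

text \<open>The interaction without stores and times. Here \<open>shift\<close> and
  \<open>answer\<close> get the past queries only, while the list seen by the program ends with the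
  current one; \<open>hyp_sum_snoc\<close> reconciles the two.\<close>

primrec play :: "bool list list \<Rightarrow> analyst \<Rightarrow> nat \<Rightarrow> int list \<Rightarrow> history \<Rightarrow> history pmf" where
  "play S A 0 ks h = return_pmf h"
| "play S A (Suc r) ks h = do {
     q \<leftarrow> A h;
     xs \<leftarrow> replicate_pmf (length S) seeds;
     let k = shift (map fst h) ks q S xs;
     play S A r (k # ks) (h @ [(q, answer (map fst h) ks q (length S) xs k)])
   }"

lemma round_bound_mono: "t \<le> t' \<Longrightarrow> round_bound \<kappa> m t \<le> round_bound \<kappa> m t'"
  by (auto simp: round_bound_def step_bound_def intro!: mult_le_mono)

text \<open>Iterates the coupling of a single round. Each round is charged as if it had
  \<open>T\<close> predecessors.\<close>

lemma rel_interact_play: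
  assumes "ready \<sigma> S ks" "length ks = length h" "S \<noteq> []" "length h + r \<le> T"
  shows "rel_pmf (\<lambda>(h', t) h''. h' = h'' \<and> t \<le> r * round_bound \<kappa> (length S) T)
    (interact \<kappa> (round_prog gprog) A r \<sigma> h) (play S A r ks h)"
  using assms
proof (induction r arbitrary: \<sigma> ks h)
  case (Suc r)
  show ?case
    unfolding interact.simps play.simps
  proof (rule rel_pmf_bindI[where R = "(=)"], simp add: pmf.rel_eq)
    fix q q' :: query assume "q = q'"
    let ?qs = "map fst h @ [q]" and ?m = "length S"
    have len: "length ks < length ?qs" and q: "q = ?qs ! length ks"
      using Suc.prems by (auto simp: nth_append)
    have hs: "hyp_sum ?qs ks q xs = hyp_sum (map fst h) ks q xs" for xs
      using Suc.prems by (intro hyp_sum_snoc) simp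
    have eq: "shift ?qs ks q S xs = shift (map fst h) ks q S xs"
      "answer ?qs ks q ?m xs k = answer (map fst h) ks q ?m xs k" for xs k
      by (simp_all add: shift_def answer_def hs)
    note runs = runs_round_prog[OF Suc.prems(1,3) len q, where \<kappa> = \<kappa>, unfolded runs_def eq]
    show "rel_pmf (\<lambda>(h', t) h''. h' = h'' \<and> t \<le> Suc r * round_bound \<kappa> ?m T)
        (exec \<kappa> ?qs (round_prog gprog) \<sigma> \<bind> (\<lambda>(\<sigma>', t).
           interact \<kappa> (round_prog gprog) A r \<sigma>' (h @ [(q, answer_of \<sigma>')]) \<bind>
             (\<lambda>(h', t'). return_pmf (h', t + t'))))
        (replicate_pmf ?m seeds \<bind> (\<lambda>xs. let k = shift (map fst h) ks q' S xs
           in play S A r (k # ks) (h @ [(q', answer (map fst h) ks q' ?m xs k)])))"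
      unfolding \<open>q = q'\<close>[symmetric]
    proof (rule rel_pmf_bindI[OF runs], goal_cases)
      case (1 p xs)
      obtain \<sigma>' t where p: "p = (\<sigma>', t)" by (cases p)
      let ?k = "shift (map fst h) ks q S xs"
      have R: "ready \<sigma>' S (?k # ks)" "answer_of \<sigma>' = answer (map fst h) ks q ?m xs ?k"
        "t \<le> round_bound \<kappa> ?m (length ks)"
        using 1 unfolding p by auto
      have t: "t \<le> round_bound \<kappa> ?m T"
        using R(3) round_bound_mono[of "length ks" T \<kappa> ?m] Suc.prems by linarith
      have "rel_pmf (\<lambda>(h', t) h''. h' = h'' \<and> t \<le> Suc r * round_bound \<kappa> ?m T)
          (interact \<kappa> (round_prog gprog) A r \<sigma>' (h @ [(q, answer_of \<sigma>')]) \<bind>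
             (\<lambda>(h', t'). return_pmf (h', t + t')))
          (play S A r (?k # ks) (h @ [(q, answer (map fst h) ks q ?m xs ?k)]) \<bind> return_pmf)"
        unfolding R(2)
        by (rule rel_pmf_bindI[OF Suc.IH[OF R(1)]]) (use Suc.prems t in auto)
      then show ?case
        unfolding p by (simp add: Let_def bind_return_pmf')
    qed
  qed
qed simp

end

context dense_target
begin

text \<open>
  The probability that the sample misrepresents a query before the hypothesis is misestimated
  (\<open>failA\<close>), and that the hypothesis is ever misestimated (\<open>failB\<close>). The estimates use seeds that are
  independent of the sample, so a plain union bound over the rounds suffices for \<open>failB\<close>.
\<close>

primrec failA :: "nat \<Rightarrow> analyst \<Rightarrow> bool list list \<Rightarrow> nat \<Rightarrow> int list \<Rightarrow> history \<Rightarrow> ennreal" where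
  "failA m A S 0 ks h = 0"
| "failA m A S (Suc r) ks h = (\<integral>\<^sup>+q. \<integral>\<^sup>+xs.
     (if badA S q then 1 else if badB (map fst h) ks q xs then 0
      else let k = shift (map fst h) ks q S xs
           in failA m A S r (k # ks) (h @ [(q, answer (map fst h) ks q m xs k)]))
     \<partial>replicate_pmf m seeds \<partial>A h)"

primrec failB :: "nat \<Rightarrow> analyst \<Rightarrow> bool list list \<Rightarrow> nat \<Rightarrow> int list \<Rightarrow> history \<Rightarrow> ennreal" where
  "failB m A S 0 ks h = 0"
| "failB m A S (Suc r) ks h = (\<integral>\<^sup>+q. \<integral>\<^sup>+xs.
     (if badB (map fst h) ks q xs then 1
      else let k = shift (map fst h) ks q S xs
           in failB m A S r (k # ks) (h @ [(q, answer (map fst h) ks q m xs k)]))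
     \<partial>replicate_pmf m seeds \<partial>A h)"

lemma target_eq:
  assumes "\<And>i. i \<in> I \<Longrightarrow> q i \<in> {-1, 1}"
  shows "measure_pmf.expectation D (\<lambda>i. real_of_int (q i)) = target q"
  unfolding target_def expectation_D
  by (rule sum.cong) (use assms in \<open>fastforce simp: sgnq_def\<close>)+

text \<open>Before the first bad event all answers are accurate. If the sample misrepresents the
  query in that round, \<open>failA\<close> pays, otherwise \<open>failB\<close>.\<close>

lemma emeasure_play_le:
  assumes A: "valid_analyst I A" and S: "S \<noteq> []" and \<epsilon>: "1 / real_of_int E \<le> \<epsilon>"
    and "accurate \<epsilon> D h"
  shows "emeasure (play S A r ks h) {h'. \<not> accurate \<epsilon> D h'} \<le>
    failA (length S) A S r ks h + failB (length S) A S r ks h"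
  using assms(4)
proof (induction r arbitrary: ks h)
  case 0
  then show ?case by simp
next
  case (Suc r)
  let ?bad = "{h'. \<not> accurate \<epsilon> D h'}" and ?qs = "map fst h" and ?m = "length S"
  let ?a = "\<lambda>q xs. (let k = shift ?qs ks q S xs
           in failA ?m A S r (k # ks) (h @ [(q, answer ?qs ks q ?m xs k)]))"
  let ?b = "\<lambda>q xs. (let k = shift ?qs ks q S xs
           in failB ?m A S r (k # ks) (h @ [(q, answer ?qs ks q ?m xs k)]))"
  let ?p = "\<lambda>q xs. emeasure (let k = shift ?qs ks q S xs
           in play S A r (k # ks) (h @ [(q, answer ?qs ks q ?m xs k)])) ?bad"
  have "emeasure (play S A (Suc r) ks h) ?bad = (\<integral>\<^sup>+q. \<integral>\<^sup>+xs. ?p q xs \<partial>replicate_pmf ?m seeds \<partial>A h)"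
    by simp
  also have "\<dots> \<le> (\<integral>\<^sup>+q. \<integral>\<^sup>+xs. (if badA S q then 1 else if badB ?qs ks q xs then 0 else ?a q xs) +
      (if badB ?qs ks q xs then 1 else ?b q xs) \<partial>replicate_pmf ?m seeds \<partial>A h)"
  proof (intro nn_integral_mono_AE, unfold AE_measure_pmf_iff, intro ballI nn_integral_mono)
    fix q xs assume q: "q \<in> set_pmf (A h)"
    have 1: "?p q xs \<le> 1" by (simp add: Let_def measure_pmf.emeasure_le_1)
    show "?p q xs \<le> (if badA S q then 1 else if badB ?qs ks q xs then 0 else ?a q xs) +
      (if badB ?qs ks q xs then 1 else ?b q xs)"
    proof (cases "badA S q \<or> badB ?qs ks q xs")
      case True
      then show ?thesis
        using 1 by (auto intro: order_trans[OF 1] add_increasing2 add_increasing)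
    next
      case False
      have "\<bar>answer ?qs ks q ?m xs (shift ?qs ks q S xs) -
          measure_pmf.expectation D (\<lambda>i. real_of_int (q i))\<bar> \<le> \<epsilon>"
        using answer_accurate[OF S, of q ?qs ks xs] False \<epsilon> target_eq[of q] A q
        unfolding valid_analyst_def by fastforce
      then have "accurate \<epsilon> D (h @ [(q, answer ?qs ks q ?m xs (shift ?qs ks q S xs))])"
        using Suc.prems by (auto simp: accurate_def)
      from Suc.IH[OF this] show ?thesis using False by (simp add: Let_def)
    qed
  qed
  also have "\<dots> = failA ?m A S (Suc r) ks h + failB ?m A S (Suc r) ks h"
    by (simp add: nn_integral_add)
  finally show ?case .
qed

section \<open>Failure probabilities\<close>

definition tailA :: "nat \<Rightarrow> real" where
  "tailA m = 2 * exp (- (real m / (512 * real_of_int E ^ 2)))"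

definition tailB :: "nat \<Rightarrow> real" where
  "tailB m = 2 * exp (- (real m / (512 * (real_of_int E * real_of_int L) ^ 2)))"

text \<open>Hoeffding's bound for deviation \<open>1 / (16 * E)\<close> and values in an interval of
  width 2, with \<open>q\<close> fixed before the sample is drawn.\<close>

lemma badA_tail: "emeasure (replicate_pmf m D) {S. badA S q} \<le> ennreal (tailA m)"
proof -
  let ?f = "\<lambda>i. real_of_int (sgnq q i)"
  have E: "0 < real_of_int E" using E_pos by simp
  have "emeasure (replicate_pmf m D) {S. badA S q} \<le> emeasure (replicate_pmf m D)
     {S. real m * (1 / (16 * real_of_int E)) \<le> \<bar>\<Sum>i\<leftarrow>S. ?f i - measure_pmf.expectation D ?f\<bar>}"
  proof (rule emeasure_mono_AE, unfold AE_measure_pmf_iff, intro ballI impI)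
    fix S assume "S \<in> set_pmf (replicate_pmf m D)" "S \<in> {S. badA S q}"
    then have l: "length S = m" and b: "badA S q" by (auto simp: set_replicate_pmf)
    have "real_of_int (sample_sum q S) - real (length S) * (2 * real_of_int E * target q) =
        2 * real_of_int E * (\<Sum>i\<leftarrow>S. ?f i - target q)"
      by (simp add: sample_sum_def sum_list_diff_const of_int_sum_list algebra_simps)
    then have "real m / 8 < 2 * real_of_int E * \<bar>\<Sum>i\<leftarrow>S. ?f i - target q\<bar>"
      using b l E unfolding badA_def by (simp add: abs_mult)
    then show "S \<in> {S. real m * (1 / (16 * real_of_int E)) \<le> \<bar>\<Sum>i\<leftarrow>S. ?f i - measure_pmf.expectation D ?f\<bar>}"
      using E by (simp add: target_def[symmetric] field_simps)
  qed auto
  also have "\<dots> \<le> ennreal (2 * exp (- (2 * real m * (1 / (16 * real_of_int E))\<^sup>2 / (1 - - 1)\<^sup>2)))"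
    by (rule replicate_pmf_tail) (use E in \<open>auto simp: sgnq_def\<close>)
  also have "2 * real m * (1 / (16 * real_of_int E))\<^sup>2 / (1 - - 1)\<^sup>2 = real m / (512 * real_of_int E ^ 2)"
    by (simp add: power_divide power_mult_distrib)
  finally show ?thesis unfolding tailA_def .
qed

text \<open>Hoeffding's bound for deviation \<open>1 / 8\<close> and values in an interval of width
  \<open>2 * cap = 4 * E * L\<close>.\<close>

lemma badB_tail: "emeasure (replicate_pmf m seeds) {xs. badB qs ks q xs} \<le> ennreal (tailB m)"
proof -
  let ?f = "\<lambda>x. real_of_int (hyp cap qs ks (g n x) * sgnq q (g n x))"
  have c: "0 < real_of_int cap" using cap_pos by simp
  have mean: "measure_pmf.expectation seeds ?f = hyp_mean qs ks q"
    by (simp add: hyp_mean_def generated_dist_def)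
  have "emeasure (replicate_pmf m seeds) {xs. badB qs ks q xs} \<le> emeasure (replicate_pmf m seeds)
     {xs. real m * (1 / 8) \<le> \<bar>\<Sum>x\<leftarrow>xs. ?f x - measure_pmf.expectation seeds ?f\<bar>}"
  proof (rule emeasure_mono_AE, unfold AE_measure_pmf_iff, intro ballI impI)
    fix xs assume "xs \<in> set_pmf (replicate_pmf m seeds)" "xs \<in> {xs. badB qs ks q xs}"
    then have l: "length xs = m" and b: "badB qs ks q xs" by (auto simp: set_replicate_pmf)
    show "xs \<in> {xs. real m * (1 / 8) \<le> \<bar>\<Sum>x\<leftarrow>xs. ?f x - measure_pmf.expectation seeds ?f\<bar>}"
      using b l unfolding badB_def mean sum_list_diff_const hyp_sum_def of_int_sum_list by simp
  qed auto
  also have "\<dots> \<le> ennreal (2 * exp (- (2 * real m * (1 / 8)\<^sup>2 / (real_of_int cap - - real_of_int cap)\<^sup>2)))"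
  proof (rule replicate_pmf_tail)
    fix x
    have "\<bar>?f x\<bar> \<le> real_of_int cap"
      using hyp_bounds[of qs ks "g n x"] by (simp add: abs_mult abs_sgnq flip: of_int_abs)
    then show "?f x \<in> {- real_of_int cap..real_of_int cap}" by (simp add: abs_le_iff)
  qed (use c in auto)
  also have "2 * real m * (1 / 8)\<^sup>2 / (real_of_int cap - - real_of_int cap)\<^sup>2 = real m / (512 * (real_of_int E * real_of_int L) ^ 2)"
    by (simp add: cap_def power_divide power_mult_distrib)
  finally show ?thesis unfolding tailB_def by simp
qed

lemma failB_le: "failB m A S r ks h \<le> ennreal (real r * tailB m)"
proof (induction r arbitrary: ks h)
  case (Suc r)
  have t: "0 \<le> tailB m" by (simp add: tailB_def)
  have "failB m A S (Suc r) ks h \<le> (\<integral>\<^sup>+q. \<integral>\<^sup>+xs. indicator {xs. badB (map fst h) ks q xs} xs +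
      ennreal (real r * tailB m) \<partial>replicate_pmf m seeds \<partial>A h)"
    unfolding failB.simps Let_def
    by (intro nn_integral_mono) (auto simp: Suc.IH indicator_def)
  also have "\<dots> \<le> (\<integral>\<^sup>+q. ennreal (tailB m) + ennreal (real r * tailB m) \<partial>A h)"
    by (intro nn_integral_mono) (simp add: nn_integral_add badB_tail add_mono)
  also have "\<dots> = ennreal (real (Suc r) * tailB m)"
    using t by (simp add: ennreal_plus[symmetric] distrib_right del: ennreal_plus)
  finally show ?case .
qed simp

text \<open>Makes the set of coefficients in the union bound finite.\<close>

lemma abs_shift_le:
  assumes "S \<noteq> []" "length xs = length S"
  shows "\<bar>shift qs ks q S xs\<bar> \<le> 2 * E + cap"
proof -
  let ?d = "sample_sum q S - hyp_sum qs ks q xs" and ?m = "int (length S)"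
  have "\<bar>shift qs ks q S xs\<bar> * ?m \<le> \<bar>?d\<bar>"
    unfolding shift_def by (rule quot0_props) (use assms in simp)
  also have "\<dots> \<le> (2 * E + cap) * ?m"
    using sample_sum_le[of q S] hyp_sum_le[of qs ks q xs] assms(2) by (simp add: distrib_right)
  finally show ?thesis using assms(1) by simp
qed

text \<open>
  A union bound over all sequences of coefficients, organised as an induction over the rounds: given
  the past, the sample influences the next state only through the coefficient \<open>k\<close>, and the potential
  pays \<open>x powr \<bar>k\<bar>\<close> for it. So the number of sequences is replaced by \<open>x\<close> to the power of the initial
  potential (times a constant if \<open>x\<close> is of the order of the number of rounds).
\<close>

lemma failA_average_le:
  fixes x :: real
  assumes m: "0 < m" and x: "1 < x" and "length ks = length h"
  defines "\<rho> \<equiv> (x + 1) / (x - 1)"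
  shows "(\<integral>\<^sup>+S. failA m A S r ks h \<partial>replicate_pmf m D) \<le>
    ennreal (tailA m * (real r * \<rho> ^ r *
      x powr (4 * potential (map fst h) ks + 2 * (real_of_int cap)\<^sup>2)))"
  using assms(3)
proof (induction r arbitrary: ks h)
  case (Suc r)
  let ?qs = "map fst h"
  \<comment> \<open>The factor 4 turns a drop of \<open>\<bar>k\<bar> / 4\<close> into a factor
    \<open>x powr (- \<bar>k\<bar>)\<close>; the second summand keeps the exponent
    nonnegative.\<close>
  define b where "b = 4 * potential ?qs ks + 2 * (real_of_int cap)\<^sup>2"
  define K where "K = {- (2 * E + cap)..2 * E + cap}"
  have \<rho>: "1 \<le> \<rho>" using x by (simp add: \<rho>_def)
  have b: "0 \<le> b" using potential_ge[of ?qs ks] by (simp add: b_def)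
  have tA: "0 \<le> tailA m" by (simp add: tailA_def)
  have K: "(\<Sum>k\<in>K. x powr (- real_of_int \<bar>k\<bar>)) \<le> \<rho>"
    using sum_powr_abs_le[OF x, of "nat (2 * E + cap)"] E_pos cap_pos by (simp add: K_def \<rho>_def)
  let ?next = "\<lambda>q xs k S. failA m A S r (k # ks) (h @ [(q, answer ?qs ks q m xs k)])"
  let ?drop = "\<lambda>q k. potential (?qs @ [q]) (k # ks) \<le> potential ?qs ks - \<bar>k\<bar> / 4"
  let ?C = "tailA m * (real r * \<rho> ^ r * x powr b)"
  \<comment> \<open>The actual coefficient depends on \<open>S\<close>, but it is one of the
    \<open>k\<close> in \<open>K\<close> that satisfy \<open>?drop\<close>. For each fixed
    \<open>k\<close> the history passed on is free of \<open>S\<close>, so the induction hypothesis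
    applies.\<close>
  have inner: "(\<integral>\<^sup>+S. (if badA S q then 1 else if badB ?qs ks q xs then 0
      else let k = shift ?qs ks q S xs in ?next q xs k S) \<partial>replicate_pmf m D) \<le>
      ennreal (tailA m * (real (Suc r) * \<rho> ^ Suc r * x powr b))"
    if xs: "length xs = m" for q xs
  proof -
    have "(\<integral>\<^sup>+S. (if badA S q then 1 else if badB ?qs ks q xs then 0
        else let k = shift ?qs ks q S xs in ?next q xs k S) \<partial>replicate_pmf m D) \<le>
      (\<integral>\<^sup>+S. indicator {S. badA S q} S + (\<Sum>k\<in>K. if ?drop q k then ?next q xs k S else 0)
        \<partial>replicate_pmf m D)"
    proof (rule nn_integral_mono_AE, unfold AE_measure_pmf_iff, intro ballI)
      fix S assume "S \<in> set_pmf (replicate_pmf m D)"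
      then have l: "length S = m" by (auto simp: set_replicate_pmf)
      then have ne: "S \<noteq> []" using m by auto
      let ?k = "shift ?qs ks q S xs"
      show "(if badA S q then 1 else if badB ?qs ks q xs then 0
        else let k = ?k in ?next q xs k S) \<le>
        indicator {S. badA S q} S + (\<Sum>k\<in>K. if ?drop q k then ?next q xs k S else 0)"
      proof (cases "badA S q \<or> badB ?qs ks q xs")
        case False
        have "?k \<in> K"
          using abs_shift_le[OF ne, of xs ?qs ks q] xs l by (auto simp: K_def abs_le_iff)
        moreover have "?drop q ?k"
          using False ne xs l Suc.prems by (intro potential_shift_le) auto
        ultimately have "?next q xs ?k S \<le> (\<Sum>k\<in>K. if ?drop q k then ?next q xs k S else 0)"
          using member_le_sum[of ?k K "\<lambda>k. if ?drop q k then ?next q xs k S else 0"]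
          by (simp add: K_def)
        then show ?thesis using False by (simp add: Let_def)
      qed auto
    qed
    also have "\<dots> = emeasure (replicate_pmf m D) {S. badA S q} +
        (\<Sum>k\<in>K. \<integral>\<^sup>+S. (if ?drop q k then ?next q xs k S else 0) \<partial>replicate_pmf m D)"
      by (simp add: nn_integral_add nn_integral_sum)
    also have "\<dots> \<le> ennreal (tailA m) + (\<Sum>k\<in>K. ennreal (?C * x powr (- real_of_int \<bar>k\<bar>)))"
    proof (intro add_mono sum_mono badA_tail)
      fix k
      show "(\<integral>\<^sup>+S. (if ?drop q k then ?next q xs k S else 0) \<partial>replicate_pmf m D) \<le>
          ennreal (?C * x powr (- real_of_int \<bar>k\<bar>))"
      proof (cases "?drop q k")
        case True
        have "(\<integral>\<^sup>+S. ?next q xs k S \<partial>replicate_pmf m D) \<le>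
          ennreal (tailA m * (real r * \<rho> ^ r *
            x powr (4 * potential (?qs @ [q]) (k # ks) + 2 * (real_of_int cap)\<^sup>2)))"
          using Suc.IH[of "k # ks" "h @ [(q, answer ?qs ks q m xs k)]"] Suc.prems by simp
        also have "\<dots> \<le> ennreal (tailA m * (real r * \<rho> ^ r * x powr (b - real_of_int \<bar>k\<bar>)))"
          using True x tA \<rho>
          by (intro ennreal_leI mult_left_mono powr_mono) (auto simp: b_def)
        also have "\<dots> = ennreal (?C * x powr (- real_of_int \<bar>k\<bar>))"
          using x by (simp add: powr_diff powr_minus divide_inverse mult.assoc)
        finally show ?thesis using True by simp
      qed simp
    qed
    also have "\<dots> = ennreal (tailA m + ?C * (\<Sum>k\<in>K. x powr (- real_of_int \<bar>k\<bar>)))"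
      using tA \<rho> by (subst sum_ennreal) (auto simp: sum_distrib_left sum_nonneg ennreal_plus)
    also have "\<dots> \<le> ennreal (tailA m * (\<rho> ^ Suc r * x powr b) + ?C * \<rho>)"
    proof (intro ennreal_leI add_mono mult_left_mono K)
      \<comment> \<open>The current round's \<open>tailA m\<close> fits into one more copy of the
        bound, which turns \<open>r\<close> into \<open>Suc r\<close>.\<close>
      have "1 * 1 \<le> \<rho> ^ Suc r * x powr b"
        using \<rho> x b by (intro mult_mono one_le_power ge_one_powr_ge_zero) auto
      then show "tailA m \<le> tailA m * (\<rho> ^ Suc r * x powr b)"
        using mult_left_mono[OF _ tA] by fastforce
    qed (use tA \<rho> in auto)
    also have "tailA m * (\<rho> ^ Suc r * x powr b) + ?C * \<rho> =
        tailA m * (real (Suc r) * \<rho> ^ Suc r * x powr b)"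
      by (simp add: algebra_simps)
    finally show ?thesis .
  qed
  \<comment> \<open>With the history fixed, query and seeds are drawn independently of the sample,
    so the average over \<open>S\<close> can be moved innermost.\<close>
  have swap: "(\<integral>\<^sup>+S. failA m A S (Suc r) ks h \<partial>replicate_pmf m D) =
     (\<integral>\<^sup>+q. \<integral>\<^sup>+xs. \<integral>\<^sup>+S. (if badA S q then 1 else if badB ?qs ks q xs then 0
      else let k = shift ?qs ks q S xs in ?next q xs k S) \<partial>replicate_pmf m D
        \<partial>replicate_pmf m seeds \<partial>A h)"
  proof -
    have comm: "(\<integral>\<^sup>+a. \<integral>\<^sup>+b. F a b \<partial>measure_pmf M2 \<partial>measure_pmf M1) =
        (\<integral>\<^sup>+b. \<integral>\<^sup>+a. F a b \<partial>measure_pmf M1 \<partial>measure_pmf M2)"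
      for F :: "'x \<Rightarrow> 'y \<Rightarrow> ennreal" and M1 M2
    proof -
      have "(\<integral>\<^sup>+z. F (fst z) (snd z) \<partial>pair_pmf M1 M2) = (\<integral>\<^sup>+z. F (snd z) (fst z) \<partial>pair_pmf M2 M1)"
        by (subst pair_commute_pmf) (simp add: case_prod_unfold)
      then show ?thesis by (simp add: nn_integral_pair_pmf')
    qed
    show ?thesis
      unfolding failA.simps by (subst comm, subst comm, rule refl)
  qed
  have "(\<integral>\<^sup>+S. failA m A S (Suc r) ks h \<partial>replicate_pmf m D) \<le>
     (\<integral>\<^sup>+q. \<integral>\<^sup>+xs. ennreal (tailA m * (real (Suc r) * \<rho> ^ Suc r * x powr b))
        \<partial>replicate_pmf m seeds \<partial>A h)"
    unfolding swap
    by (intro nn_integral_mono nn_integral_mono_AE, unfold AE_measure_pmf_iff, intro ballI inner)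
       (auto simp: set_replicate_pmf)
  also have "\<dots> = ennreal (tailA m * (real (Suc r) * \<rho> ^ Suc r * x powr b))"
    by simp
  finally show ?case unfolding b_def .
qed simp

lemma rel_experiment:
  assumes M: "0 < M" and L: "L = \<lceil>1 / lam\<rceil>" and E: "E = \<lceil>1 / \<epsilon>\<rceil>"
  shows "rel_pmf (\<lambda>(h', t) h''. h' = h'' \<and> t \<le> T * round_bound \<kappa> M T)
    (adaptive_experiment \<kappa> (round_prog gprog) M n lam \<epsilon> T D A)
    (bind_pmf (replicate_pmf M D) (\<lambda>S. play S A T [] []))"
proof -
  have ready: "ready (initial_store n lam \<epsilon> T S) S []" for S
    by (simp add: ready_def initial_store_def flip: L E)
  show ?thesis
    unfolding adaptive_experiment_def
  proof (rule rel_pmf_bindI[where R = "\<lambda>S S'. S = S' \<and> length S = M"])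
    show "rel_pmf (\<lambda>S S'. S = S' \<and> length S = M) (replicate_pmf M D) (replicate_pmf M D)"
      by (rule rel_pmf_reflI) (auto simp: set_replicate_pmf)
  next
    fix S S' :: "bool list list" assume "S = S' \<and> length S = M"
    then show "rel_pmf (\<lambda>(h', t) h''. h' = h'' \<and> t \<le> T * round_bound \<kappa> M T)
        (interact \<kappa> (round_prog gprog) A T (initial_store n lam \<epsilon> T S) []) (play S' A T [] [])"
      using rel_interact_play[OF ready, of "[]" S T T \<kappa> A] M by auto
  qed
qed

text \<open>The initial potential is 0, which leaves the exponent \<open>2 * cap\<^sup>2\<close>.
  The parameter \<open>x\<close> trades this power against the factor per round.\<close>

lemma prob_not_accurate_le:
  fixes x :: real
  assumes A: "valid_analyst I A" and M: "0 < M" and \<epsilon>: "1 / real_of_int E \<le> \<epsilon>" and x: "1 < x"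
  shows "measure_pmf.prob (bind_pmf (replicate_pmf M D) (\<lambda>S. play S A T [] [])) {h. \<not> accurate \<epsilon> D h} \<le>
    tailA M * (real T * ((x + 1) / (x - 1)) ^ T * x powr (2 * (real_of_int cap)\<^sup>2)) + real T * tailB M"
proof -
  let ?b = "tailA M * (real T * ((x + 1) / (x - 1)) ^ T * x powr (2 * (real_of_int cap)\<^sup>2))"
  have pos: "0 \<le> ?b" "0 \<le> real T * tailB M"
    using x by (simp_all add: tailA_def tailB_def)
  have "emeasure (measure_pmf (bind_pmf (replicate_pmf M D) (\<lambda>S. play S A T [] []))) {h. \<not> accurate \<epsilon> D h} \<le>
      (\<integral>\<^sup>+S. failA M A S T [] [] + failB M A S T [] [] \<partial>replicate_pmf M D)"
    unfolding emeasure_bind_pmf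
  proof (rule nn_integral_mono_AE, unfold AE_measure_pmf_iff, intro ballI)
    fix S assume "S \<in> set_pmf (replicate_pmf M D)"
    then have S: "length S = M" by (auto simp: set_replicate_pmf)
    then show "emeasure (play S A T [] []) {h. \<not> accurate \<epsilon> D h} \<le>
        failA M A S T [] [] + failB M A S T [] []"
      using emeasure_play_le[OF A _ \<epsilon>, of S "[]" T "[]"] M by (auto simp: accurate_def)
  qed
  also have "\<dots> \<le> ennreal ?b + ennreal (real T * tailB M)"
  proof -
    have "(\<integral>\<^sup>+S. failB M A S T [] [] \<partial>replicate_pmf M D) \<le>
        (\<integral>\<^sup>+S. ennreal (real T * tailB M) \<partial>replicate_pmf M D)"
      by (intro nn_integral_mono failB_le)
    then have "(\<integral>\<^sup>+S. failB M A S T [] [] \<partial>replicate_pmf M D) \<le> ennreal (real T * tailB M)"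
      by simp
    moreover have "(\<integral>\<^sup>+S. failA M A S T [] [] \<partial>replicate_pmf M D) \<le> ennreal ?b"
      using failA_average_le[OF M x, of "[]" "[]" A T] by (simp add: potential_Nil)
    ultimately show ?thesis by (simp add: nn_integral_add add_mono)
  qed
  also have "\<dots> = ennreal (?b + real T * tailB M)"
    using pos by simp
  finally show ?thesis
    using pos by (simp only: measure_pmf.emeasure_eq_measure ennreal_le_iff add_nonneg_nonneg)
qed

end

section \<open>Sample size and running time\<close>

definition sample_const :: "real \<Rightarrow> real" where
  "sample_const \<delta> = 512 * (24 + 2 * ln (4 / \<delta>))"

definition sample_size :: "real \<Rightarrow> int \<Rightarrow> int \<Rightarrow> nat \<Rightarrow> nat" where
  "sample_size \<delta> L E T = nat \<lceil>sample_const \<delta> * real_of_int L ^ 2 * real_of_int E ^ 4 * ln (real T)\<rceil>"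

lemma ln_ge_half:
  assumes "2 \<le> T" shows "1 / 2 \<le> ln (real T)"
proof -
  have "1 / 2 \<le> ln (2 :: real)" using exp_half_le2 ln_ge_iff[of "2 :: real" "1 / 2"] by simp
  also have "\<dots> \<le> ln (real T)" using assms by simp
  finally show ?thesis .
qed

text \<open>Each of the two terms is at most \<open>2 * exp (- d) = \<delta> / 2\<close>. In
  \<open>sample_const\<close>, 512 cancels the denominators of the tails, 24 covers
  \<open>l + 2 + 16 * (b * a) * l\<close> and \<open>2 * d * l\<close> covers \<open>d\<close>, both
  by \<open>1 / 2 \<le> l\<close>.\<close>

lemma sampling_error_le:
  fixes \<delta> :: real
  assumes \<delta>: "0 < \<delta>" "\<delta> < 1" and L: "1 \<le> L" and E: "1 \<le> E" and T: "2 \<le> T"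
    and M: "sample_const \<delta> * real_of_int L ^ 2 * real_of_int E ^ 4 * ln (real T) \<le> M"
  shows "2 * exp (- (M / (512 * real_of_int E ^ 2))) *
      (real T * ((real T + 1 + 1) / (real T + 1 - 1)) ^ T *
        (real T + 1) powr (8 * (real_of_int E * real_of_int L)\<^sup>2)) +
      real T * (2 * exp (- (M / (512 * (real_of_int E * real_of_int L) ^ 2)))) \<le> \<delta>"
proof -
  define d l a b where "d = ln (4 / \<delta>)" and "l = ln (real T)" and "a = real_of_int L ^ 2"
    and "b = real_of_int E ^ 2"
  have d: "0 < d" using \<delta> by (simp add: d_def)
  have l: "1 / 2 \<le> l" using ln_ge_half[OF T] by (simp add: l_def)
  have a: "1 \<le> a" and b: "1 \<le> b" using L E by (simp_all add: a_def b_def)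
  have ab: "1 \<le> b * a" using mult_mono[OF b a] b by simp
  have EL: "(real_of_int E * real_of_int L)\<^sup>2 = b * a" by (simp add: a_def b_def power_mult_distrib)
  have E4: "real_of_int E ^ 4 = b * b" by (simp add: b_def flip: power_add)
  have M': "512 * ((24 + 2 * d) * a * (b * b) * l) \<le> M"
    using M unfolding sample_const_def d_def[symmetric] a_def[symmetric] E4 l_def[symmetric]
    by (simp only: mult.assoc)
  have \<delta>_exp: "\<delta> / 4 = exp (- d)"
    using \<delta> by (simp add: d_def exp_minus)
  have T_exp: "real T = exp l" using T by (simp add: l_def)
  have A1: "(24 + 2 * d) * (b * a) * l \<le> M / (512 * b)"
    using M' b by (simp add: field_simps)
  have A2: "(24 + 2 * d) * b * l \<le> M / (512 * (b * a))"
    using M' b a by (simp add: field_simps)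
  have dl: "d \<le> 2 * d * l" using l d by (simp add: mult_left_mono)
  \<comment> \<open>With \<open>x = T + 1\<close> the factor per round is \<open>1 + 2 / T\<close>,
    so \<open>T\<close> rounds cost only a constant, while \<open>ln x\<close> stays of order
    \<open>ln T\<close>.\<close>
  have ratio: "((real T + 1 + 1) / (real T + 1 - 1)) ^ T \<le> exp 2"
  proof -
    have "((real T + 1 + 1) / (real T + 1 - 1)) ^ T = (1 + 2 / real T) ^ T"
      using T by (simp add: field_simps)
    also have "\<dots> \<le> exp (2 / real T) ^ T"
      by (intro power_mono) (use T in \<open>simp_all add: exp_ge_add_one_self\<close>)
    also have "\<dots> = exp 2" using T by (simp flip: exp_of_nat_mult)
    finally show ?thesis .
  qed
  have "2 * real T \<le> real T * real T" using T by (intro mult_right_mono) auto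
  then have "real T + 1 \<le> real T * real T" using T by linarith
  then have "ln (real T + 1) \<le> ln (real T * real T)" using T by simp
  then have lT: "ln (real T + 1) \<le> 2 * l" using T by (simp add: ln_mult l_def)
  have "(real T + 1) powr (8 * (b * a)) = exp (8 * (b * a) * ln (real T + 1))"
    by (simp add: powr_def)
  also have "\<dots> \<le> exp (8 * (b * a) * (2 * l))"
    using lT ab by (simp only: exp_le_cancel_iff) (intro mult_left_mono, auto)
  finally have pw: "(real T + 1) powr (8 * (b * a)) \<le> exp (16 * (b * a) * l)" by (simp add: mult_ac)
  have "2 * exp (- (M / (512 * b))) * (real T * ((real T + 1 + 1) / (real T + 1 - 1)) ^ T *
        (real T + 1) powr (8 * (b * a))) \<le>
      2 * exp (- (M / (512 * b))) * (exp l * exp 2 * exp (16 * (b * a) * l))"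
    unfolding T_exp[symmetric]
    by (intro mult_left_mono mult_mono ratio pw) auto
  also have "\<dots> = 2 * exp (- (M / (512 * b)) + l + 2 + 16 * (b * a) * l)"
    by (simp only: exp_add mult.assoc)
  also have "\<dots> \<le> 2 * exp (- d)"
  proof -
    have "l \<le> b * a * l" "2 * d * l \<le> 2 * d * l * (b * a)"
      using ab l d mult_right_mono[OF ab, of l] mult_left_mono[OF ab, of "2 * d * l"] by auto
    moreover have "(24 + 2 * d) * (b * a) * l = 24 * (b * a * l) + 2 * d * l * (b * a)"
      by (simp add: algebra_simps)
    ultimately have "- (M / (512 * b)) + l + 2 + 16 * (b * a) * l \<le> - d"
      using A1 dl l by linarith
    then show ?thesis by simp
  qed
  finally have 1: "2 * exp (- (M / (512 * b))) * (real T * ((real T + 1 + 1) / (real T + 1 - 1)) ^ T *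
        (real T + 1) powr (8 * (b * a))) \<le> \<delta> / 2"
    using \<delta>_exp by simp
  have "real T * (2 * exp (- (M / (512 * (b * a))))) = 2 * exp (l - M / (512 * (b * a)))"
    unfolding T_exp by (simp add: exp_diff exp_minus field_simps)
  also have "\<dots> \<le> 2 * exp (- d)"
  proof -
    have "(24 + 2 * d) * l * 1 \<le> (24 + 2 * d) * l * b"
      using b d l by (intro mult_left_mono) auto
    moreover have "(24 + 2 * d) * l = 24 * l + 2 * d * l" "(24 + 2 * d) * l * b = (24 + 2 * d) * b * l"
      by (simp_all add: algebra_simps)
    ultimately have "l - M / (512 * (b * a)) \<le> - d" using A2 dl l by linarith
    then show ?thesis by simp
  qed
  finally have 2: "real T * (2 * exp (- (M / (512 * (b * a))))) \<le> \<delta> / 2"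
    using \<delta>_exp by simp
  show ?thesis
    unfolding EL unfolding b_def[symmetric] using 1 2 by simp
qed

lemma ceiling_inverse_le:
  fixes x :: real
  assumes "0 < x" "x \<le> 1"
  shows "1 \<le> \<lceil>1 / x\<rceil>" "real_of_int \<lceil>1 / x\<rceil> \<le> 2 / x"
proof -
  have "1 \<le> 1 / x" using assms by simp
  then show "1 \<le> \<lceil>1 / x\<rceil>" by linarith
  have "real_of_int \<lceil>1 / x\<rceil> \<le> 1 / x + 1" by linarith
  also have "\<dots> \<le> 2 / x" using \<open>1 \<le> 1 / x\<close> by simp
  finally show "real_of_int \<lceil>1 / x\<rceil> \<le> 2 / x" .
qed

text \<open>Rounding up at most doubles \<open>1 / lam\<close> and \<open>1 / \<epsilon>\<close>,
  hence \<open>64 = 2^2 * 2^4\<close>. The outer ceiling adds at most 1, absorbed through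
  \<open>1 \<le> 2 * ln T\<close>.\<close>

lemma sample_size_le:
  fixes \<delta> lam \<epsilon> :: real
  assumes \<delta>: "0 < \<delta>" "\<delta> < 1" and lam: "0 < lam" "lam \<le> 1" and \<epsilon>: "0 < \<epsilon>" "\<epsilon> \<le> 1" and T: "2 \<le> T"
  shows "real (sample_size \<delta> \<lceil>1 / lam\<rceil> \<lceil>1 / \<epsilon>\<rceil> T) \<le>
    64 * (sample_const \<delta> + 2) * (1 / lam ^ 2) * (1 / \<epsilon> ^ 4) * ln (real T)"
proof -
  let ?L = "real_of_int \<lceil>1 / lam\<rceil>" and ?E = "real_of_int \<lceil>1 / \<epsilon>\<rceil>" and ?l = "ln (real T)"
  note Lb = ceiling_inverse_le[OF lam] and Eb = ceiling_inverse_le[OF \<epsilon>]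
  have l: "1 \<le> 2 * ?l" using ln_ge_half[OF T] by simp
  have c: "0 \<le> sample_const \<delta>" using \<delta> by (simp add: sample_const_def)
  have neg: "- 1 < 1 / lam" "- 1 < 1 / \<epsilon>"
    using lam \<epsilon> by (auto intro: less_trans[of _ 0])
  have LE1: "1 \<le> ?L ^ 2 * ?E ^ 4"
    using mult_mono[of 1 "?L ^ 2" 1 "?E ^ 4"] Lb(1) Eb(1) by simp
  have ceil: "real (nat \<lceil>y\<rceil>) \<le> y + 1" if "0 \<le> y" for y :: real
    using that by linarith
  have "real (sample_size \<delta> \<lceil>1 / lam\<rceil> \<lceil>1 / \<epsilon>\<rceil> T) \<le> sample_const \<delta> * ?L ^ 2 * ?E ^ 4 * ?l + 1"
    unfolding sample_size_def using c l Lb(1) Eb(1) by (intro ceil) auto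
  also have "\<dots> \<le> sample_const \<delta> * ?L ^ 2 * ?E ^ 4 * ?l + ?L ^ 2 * ?E ^ 4 * (2 * ?l)"
    using mult_mono[OF LE1 l] by simp
  also have "sample_const \<delta> * ?L ^ 2 * ?E ^ 4 * ?l + ?L ^ 2 * ?E ^ 4 * (2 * ?l) =
      (sample_const \<delta> + 2) * (?L ^ 2 * ?E ^ 4) * ?l"
    by (simp add: algebra_simps)
  also have "\<dots> \<le> (sample_const \<delta> + 2) * ((2 / lam) ^ 2 * (2 / \<epsilon>) ^ 4) * ?l"
    using c l Lb Eb neg by (intro mult_right_mono mult_left_mono mult_mono power_mono) auto
  also have "\<dots> = 64 * (sample_const \<delta> + 2) * (1 / lam ^ 2) * (1 / \<epsilon> ^ 4) * ?l"
    by (simp add: power_divide)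
  finally show ?thesis by simp
qed

text \<open>The degree 10 is 7 for the sample size, 2 for the work per sample point and 1 for the
  rounds; \<open>390 = 100 + 20 + 270\<close> collects the work outside the sampling loop.\<close>

lemma (in generator) total_time_le:
  fixes X C :: real
  assumes X: "4 \<le> X" "real n \<le> X" "real (\<tau> n) \<le> X" "real \<kappa> \<le> X" "real T \<le> X"
    "real_of_int L \<le> 2 * X" "real_of_int E \<le> 2 * X" and C: "0 \<le> C" and m: "real m \<le> C * X ^ 7"
  shows "real (T * round_bound \<kappa> m T) \<le> (390 + 20 * C) * X ^ 10"
proof -
  have p: "1 \<le> X ^ k" for k using X(1) by (intro one_le_power) auto
  have X2: "4 * X \<le> X ^ 2" using X(1) by (simp add: power2_eq_square)
  have TX: "real T * real \<kappa> \<le> X ^ 2"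
    unfolding power2_eq_square using X by (intro mult_mono) auto
  have "real (1 + step_bound \<kappa> T) \<le> 20 * X ^ 2"
    using X X2 TX by (simp add: step_bound_def distrib_left)
  then have 1: "real (m * (1 + step_bound \<kappa> T)) \<le> C * X ^ 7 * (20 * X ^ 2)"
    unfolding of_nat_mult using m C X(1) by (intro mult_mono) auto
  have LE: "real_of_int E * real_of_int L \<le> 2 * X * (2 * X)"
    using X L_pos E_pos by (intro mult_mono) auto
  have "real (nat (2 * E + cap)) = 2 * real_of_int E + 2 * (real_of_int E * real_of_int L)"
    using cap_pos E_pos by (simp add: cap_def)
  then have 2: "real (nat (2 * E + cap)) \<le> 9 * X ^ 2"
    using LE X(7) X2 unfolding power2_eq_square by linarith
  have 3: "real (nat L) \<le> 2 * X" using X L_pos by simp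
  have "X * 1 \<le> X * X ^ 8" "X ^ 2 * 1 \<le> X ^ 2 * X ^ 7"
    using p X(1) by (intro mult_left_mono; simp)+
  then have 4: "X \<le> X ^ 9" "X ^ 2 \<le> X ^ 9" by (simp_all flip: power_Suc power_add)
  have "real (round_bound \<kappa> m T) \<le> (390 + 20 * C) * X ^ 9"
  proof -
    have "C * X ^ 7 * (20 * X ^ 2) = 20 * C * X ^ 9"
      by (simp add: mult_ac flip: power_add)
    then show ?thesis
      using 1 2 3 4 p[of 9] unfolding round_bound_def of_nat_add of_nat_mult[of _ 10]
        of_nat_mult[of _ 30] distrib_right of_nat_numeral by linarith
  qed
  then have "real T * real (round_bound \<kappa> m T) \<le> X * ((390 + 20 * C) * X ^ 9)"
    using X C by (intro mult_mono) auto
  also have "\<dots> = (390 + 20 * C) * X ^ 10"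
    by (simp add: mult_ac flip: power_Suc)
  finally show ?thesis by simp
qed

theorem theorem1:
  fixes \<delta> :: real
  assumes "0 < \<delta>" and "\<delta> < 1"
  shows "\<exists>(C::real) (K::real) (d::nat).
    \<forall>(I :: nat \<Rightarrow> bool list set) (g :: nat \<Rightarrow> bool list \<Rightarrow> bool list)
      (gprog :: com) (p\<^sub>g :: nat poly) (p\<^sub>q :: nat poly).
      (\<forall>n. finite (I n)) \<longrightarrow>
      (\<forall>n. \<forall>x\<in>bitstrings n. g n x \<in> I n) \<longrightarrow>
      computes_within gprog g (poly p\<^sub>g) \<longrightarrow>
      (\<exists>(mech :: com) (M :: nat \<Rightarrow> real \<Rightarrow> real \<Rightarrow> nat \<Rightarrow> nat).
        \<forall>n (lam::real) (\<epsilon>::real) T.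
          0 < lam \<longrightarrow> lam \<le> 1 \<longrightarrow> 0 < \<epsilon> \<longrightarrow> \<epsilon> < 1 \<longrightarrow> 2 \<le> T \<longrightarrow>
          real (M n lam \<epsilon> T) \<le> C * (1 / lam ^ 2) * (1 / \<epsilon> ^ 4) * ln (real T) \<and>
          (\<forall>(D :: bool list pmf) (A :: analyst).
            set_pmf D \<subseteq> I n \<longrightarrow>
            dense_wrt lam (I n) D (generated_dist n (g n)) \<longrightarrow>
            valid_analyst (I n) A \<longrightarrow>
            (let E = adaptive_experiment (poly p\<^sub>q n) mech (M n lam \<epsilon> T) n lam \<epsilon> T D A in
              measure_pmf.prob E {(h, t). accurate \<epsilon> D h} \<ge> 1 - \<delta> \<and>
              (\<forall>(h, t)\<in>set_pmf E.
                real t \<le> K * (real n + 1 / \<epsilon> + 1 / lam + real T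
                               + real (poly p\<^sub>g n) + real (poly p\<^sub>q n)) ^ d))))"
proof -
  define C where "C = 64 * (sample_const \<delta> + 2)"
  have C: "0 \<le> C" using assms by (simp add: C_def sample_const_def)
  have main: "real M \<le> C * (1 / lam ^ 2) * (1 / \<epsilon> ^ 4) * ln (real T) \<and>
      (\<forall>D A. set_pmf D \<subseteq> I n \<longrightarrow> dense_wrt lam (I n) D (generated_dist n (g n)) \<longrightarrow>
         valid_analyst (I n) A \<longrightarrow>
         (let E = adaptive_experiment (poly p\<^sub>q n) (round_prog gprog) M n lam \<epsilon> T D A in
            measure_pmf.prob E {(h, t). accurate \<epsilon> D h} \<ge> 1 - \<delta> \<and>
            (\<forall>(h, t)\<in>set_pmf E. real t \<le> (390 + 20 * C) * (real n + 1 / \<epsilon> + 1 / lam + real T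
                               + real (poly p\<^sub>g n) + real (poly p\<^sub>q n)) ^ 10)))"
    if I: "\<forall>n. finite (I n)" "\<forall>n. \<forall>x\<in>bitstrings n. g n x \<in> I n"
      and gprog: "computes_within gprog g (poly p\<^sub>g)"
      and lam: "0 < lam" "lam \<le> 1" and \<epsilon>: "0 < \<epsilon>" "\<epsilon> < 1" and T: "2 \<le> T"
      and M_def: "M = sample_size \<delta> \<lceil>1 / lam\<rceil> \<lceil>1 / \<epsilon>\<rceil> T"
    for I :: "nat \<Rightarrow> bool list set" and g gprog p\<^sub>g p\<^sub>q n and lam \<epsilon> :: real and T M
  proof (intro conjI allI impI)
    let ?L = "\<lceil>1 / lam\<rceil>" and ?E = "\<lceil>1 / \<epsilon>\<rceil>"
    note Lb = ceiling_inverse_le[OF lam] and Eb = ceiling_inverse_le[OF \<epsilon>(1) less_imp_le[OF \<epsilon>(2)]]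
    show M_le: "real M \<le> C * (1 / lam ^ 2) * (1 / \<epsilon> ^ 4) * ln (real T)"
      unfolding M_def C_def using assms lam \<epsilon> T by (intro sample_size_le) auto
    have M_ge: "sample_const \<delta> * real_of_int ?L ^ 2 * real_of_int ?E ^ 4 * ln (real T) \<le> real M"
      unfolding M_def sample_size_def by (rule real_nat_ceiling_ge)
    have "0 < sample_const \<delta> * real_of_int ?L ^ 2 * real_of_int ?E ^ 4 * ln (real T)"
    proof (intro mult_pos_pos zero_less_power)
      show "0 < sample_const \<delta>"
        using assms by (auto simp: sample_const_def intro!: add_pos_pos)
    qed (use Lb(1) Eb(1) T in simp_all)
    then have M_pos: "0 < M" using M_ge by simp
    fix D :: "bool list pmf" and A :: analyst
    assume D: "set_pmf D \<subseteq> I n" and dns: "dense_wrt lam (I n) D (generated_dist n (g n))"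
      and A: "valid_analyst (I n) A"
    \<comment> \<open>Since \<open>1 / lam \<le> L\<close>, the density assumption holds with the
      integer that the program sees.\<close>
    have "pmf D i \<le> real_of_int ?L * pmf (generated_dist n (g n)) i" if "i \<in> I n" for i
    proof -
      have "pmf D i \<le> 1 / lam * pmf (generated_dist n (g n)) i"
        using dns that by (simp add: dense_wrt_def)
      also have "\<dots> \<le> real_of_int ?L * pmf (generated_dist n (g n)) i"
        by (intro mult_right_mono) auto
      finally show ?thesis .
    qed
    then interpret dense_target n g gprog "poly p\<^sub>g" ?L ?E "I n" D
      using I gprog D Lb(1) Eb(1) by unfold_locales auto
    let ?\<kappa> = "poly p\<^sub>q n"
    define X where "X = real n + 1 / \<epsilon> + 1 / lam + real T + real (poly p\<^sub>g n) + real ?\<kappa>"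
    let ?R = "\<lambda>(h', t) h''. h' = h'' \<and> t \<le> T * round_bound ?\<kappa> M T"
    let ?X = "adaptive_experiment ?\<kappa> (round_prog gprog) M n lam \<epsilon> T D A"
    have rel: "rel_pmf ?R ?X (bind_pmf (replicate_pmf M D) (\<lambda>S. play S A T [] []))"
      by (rule rel_experiment[OF M_pos]) auto
    \<comment> \<open>Coupled histories are equal, so an inaccurate run forces an inaccurate
      play.\<close>
    have "measure_pmf.prob ?X {(h, t). \<not> accurate \<epsilon> D h} \<le>
        measure_pmf.prob (bind_pmf (replicate_pmf M D) (\<lambda>S. play S A T [] [])) {h. \<not> accurate \<epsilon> D h}"
      by (rule order_trans[OF rel_pmf_measureD[OF rel] measure_pmf.finite_measure_mono]) auto
    \<comment> \<open>The choice \<open>x = T + 1\<close> is made here.\<close>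
    also have "\<dots> \<le> tailA M * (real T * ((real T + 1 + 1) / (real T + 1 - 1)) ^ T *
        (real T + 1) powr (2 * (real_of_int cap)\<^sup>2)) + real T * tailB M"
    proof (rule prob_not_accurate_le[OF A M_pos])
      have "\<epsilon> * (1 / \<epsilon>) \<le> \<epsilon> * real_of_int ?E"
        using \<epsilon>(1) by (intro mult_left_mono) auto
      moreover have "0 < real_of_int ?E" using Eb(1) by linarith
      ultimately show "1 / real_of_int ?E \<le> \<epsilon>" using \<epsilon>(1) by (simp add: pos_divide_le_eq)
    qed (use T in simp)
    also have "2 * (real_of_int cap)\<^sup>2 = 8 * (real_of_int ?E * real_of_int ?L)\<^sup>2"
      by (simp add: cap_def power_mult_distrib)
    also have "tailA M * (real T * ((real T + 1 + 1) / (real T + 1 - 1)) ^ T *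
        (real T + 1) powr (8 * (real_of_int ?E * real_of_int ?L)\<^sup>2)) + real T * tailB M \<le> \<delta>"
      unfolding tailA_def tailB_def by (rule sampling_error_le[OF assms Lb(1) Eb(1) T M_ge])
    finally have fail: "measure_pmf.prob ?X {(h, t). \<not> accurate \<epsilon> D h} \<le> \<delta>" .
    have "{(h, t). accurate \<epsilon> D h} = space (measure_pmf ?X) - {(h, t). \<not> accurate \<epsilon> D h}" by auto
    then have ok: "1 - \<delta> \<le> measure_pmf.prob ?X {(h, t). accurate \<epsilon> D h}"
      using fail measure_pmf.prob_compl[of "{(h, t). \<not> accurate \<epsilon> D h}" ?X] by simp
    have inv: "1 \<le> 1 / lam" "1 \<le> 1 / \<epsilon>" using lam \<epsilon> by simp_all
    \<comment> \<open>The coupling relates every point of the support, so the time bound holds for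
      every possible run.\<close>
    have time: "real t \<le> (390 + 20 * C) * X ^ 10" if "(h, t) \<in> set_pmf ?X" for h t
    proof -
      have "t \<le> T * round_bound ?\<kappa> M T"
        using rel_setD1[OF rel_pmf_imp_rel_set[OF rel] that] by auto
      then have "real t \<le> real (T * round_bound ?\<kappa> M T)" by (simp only: of_nat_le_iff)
      also have "\<dots> \<le> (390 + 20 * C) * X ^ 10"
      proof (rule total_time_le[OF _ _ _ _ _ _ _ C])
        have "1 / lam ^ 2 * (1 / \<epsilon> ^ 4) * ln (real T) \<le> X ^ 2 * X ^ 4 * X"
        proof (intro mult_mono)
          show "1 / lam ^ 2 \<le> X ^ 2"
            unfolding power_one_over[symmetric] by (rule power_mono) (use inv lam \<epsilon> in \<open>auto simp: X_def\<close>)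
          show "1 / \<epsilon> ^ 4 \<le> X ^ 4"
            unfolding power_one_over[symmetric] by (rule power_mono) (use inv lam \<epsilon> in \<open>auto simp: X_def\<close>)
          have "ln (real T) \<le> real T" using T ln_le_minus_one[of "real T"] by simp
          then show "ln (real T) \<le> X" using inv by (simp add: X_def)
        qed (use inv T lam \<epsilon> in \<open>auto simp: X_def\<close>)
        also have "X ^ 2 * X ^ 4 * X = X ^ 7" by (simp flip: power_add power_Suc2)
        finally have "C * (1 / lam ^ 2 * (1 / \<epsilon> ^ 4) * ln (real T)) \<le> C * X ^ 7"
          using C by (rule mult_left_mono)
        then show "real M \<le> C * X ^ 7" using M_le by (simp add: mult.assoc)
      qed (use inv T Lb(2) Eb(2) in \<open>auto simp: X_def\<close>)
      finally show ?thesis .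
    qed
    show "let E = ?X in
            measure_pmf.prob E {(h, t). accurate \<epsilon> D h} \<ge> 1 - \<delta> \<and>
            (\<forall>(h, t)\<in>set_pmf E. real t \<le> (390 + 20 * C) * (real n + 1 / \<epsilon> + 1 / lam + real T
                               + real (poly p\<^sub>g n) + real ?\<kappa>) ^ 10)"
      using ok time unfolding Let_def X_def by auto
  qed
  show ?thesis
    by (rule exI[of _ C], rule exI[of _ "390 + 20 * C"], rule exI[of _ 10], intro allI impI,
        rule_tac x = "round_prog gprog" in exI,
        rule_tac x = "\<lambda>n lam \<epsilon> T. sample_size \<delta> \<lceil>1 / lam\<rceil> \<lceil>1 / \<epsilon>\<rceil> T" in exI, intro allI impI,
        rule main) simp_all
qed

end
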